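(* Let $k$ be an algebraically closed field of characteristic $2$, let $\nu\ge 1$ and $m\ge 2(3\nu-1)$. Let $f\in R_{2\nu\times m}$ be the sum of all monomials that depend in a multi-linear fashion on the first $2(3\nu-1)$ indeterminate vectors $v^{(1)},\dots,v^{(2(3\nu-1))}$ (and do not involve the rest), and the two rows of whose type coincide, each row being a permutation of $(2,3,3,\dots,3)$ (one $2$ and $\nu-1$ $3$'s). Then: (i) The polynomial $f$ is an orthogonal invariant, i.e. $f\in R_{2\nu\times m}^{O(2\nu)}$. (ii) The polynomial $f$ is not expressible as a polynomial in the $Q^{(i)}$ and $B^{(ij)}$.
   Context: $k$ is an algebraically closed field of characteristic $2$. $O(2\nu)$ is the group of linear automorphisms of $k^{2\nu}$ (coordinates $x_1,\dots,x_\nu,y_1,\dots,y_\nu$) preserving the quadratic form $q=x_1y_1+\dots+x_\nu y_\nu$; its polar form is $\beta(v,w)=q(v+w)-q(v)-q(w)$. $R_{2\nu\times m}$ is the algebra of polynomials over $k$ in the coordinates $x_t^{(i)},y_t^{(i)}$ ($1\le t\le\nu$, $1\le i\le m$) of $m$ indeterminate vectors $v^{(1)},\dots,v^{(m)}$ in $k^{2\nu}$, with $O(2\nu)$ acting diagonally; $R_{2\nu\times m}^{O(2\nu)}$ is the subalgebra of invariants. $Q^{(i)}=q(v^{(i)})=\sum_{t}x_t^{(i)}y_t^{(i)}$ and $B^{(ij)}=\beta(v^{(i)},v^{(j)})=\sum_t\left(x_t^{(i)}y_t^{(j)}+y_t^{(i)}x_t^{(j)}\right)$. A monomial depends in a multi-linear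 fashion on certain vectors if it has degree exactly $1$ in the coordinates of each of them. The type of such a monomial is the $2\times\nu$ matrix $\begin{pmatrix}\sigma_1&\cdots&\sigma_\nu\\ \tau_1&\cdots&\tau_\nu\end{pmatrix}$, where $\sigma_t$ is the number of factors of the monomial of the form $x_t^{(i)}$ (for some $i$) and $\tau_t$ is the number of factors of the form $y_t^{(i)}$. *)

theory Defs
  imports
    "HOL-Analysis.Cartesian_Space"
    "HOL-Library.Poly_Mapping"
    "HOL-Library.Multiset"
    "HOL-Computational_Algebra.Polynomial"
begin

section \<open>Multivariate polynomials\<close>

text \<open>
  A monomial is a finitely supported exponent function, and a polynomial is a finitely supported
  function from monomials to coefficients. The multiplication which \<^theory>\<open>HOL-Library.Poly_Mapping\<close>
  puts on the latter is convolution, so this is the usual polynomial ring.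
\<close>

type_synonym 'v monomial = "'v \<Rightarrow>\<^sub>0 nat"
type_synonym ('v, 'a) mpoly = "'v monomial \<Rightarrow>\<^sub>0 'a"

definition Const :: "'a::zero \<Rightarrow> ('v, 'a) mpoly" where
  "Const c = Poly_Mapping.single 0 c"

definition Var :: "'v \<Rightarrow> ('v, 'a::zero_neq_one) mpoly" where
  "Var x = Poly_Mapping.single (Poly_Mapping.single x 1) 1"

definition polys_in :: "'v set \<Rightarrow> ('v, 'a::zero) mpoly set" where
  "polys_in V = {p. \<forall>mon \<in> Poly_Mapping.keys p. Poly_Mapping.keys mon \<subseteq> V}"

definition mpoly_subst :: "('w \<Rightarrow> ('v, 'a::comm_ring_1) mpoly) \<Rightarrow> ('w, 'a) mpoly \<Rightarrow> ('v, 'a) mpoly" where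
  "mpoly_subst s p =
     (\<Sum>mon\<in>Poly_Mapping.keys p. Const (Poly_Mapping.lookup p mon) *
        (\<Prod>x\<in>Poly_Mapping.keys mon. s x ^ Poly_Mapping.lookup mon x))"

lemma mpoly_subst_Const [simp]: "mpoly_subst s (Const c) = Const c"
  by (simp add: mpoly_subst_def Const_def)

lemma mpoly_subst_Var [simp]: "mpoly_subst s (Var x) = s x"
  by (simp add: mpoly_subst_def Const_def Var_def single_one)


section \<open>The quadratic form and its orthogonal group\<close>

text \<open>
  The number \<open>\<nu>\<close> is \<open>CARD('n)\<close>. Coordinates of \<open>k\<^sup>2\<^sup>\<nu>\<close> are indexed by \<^typ>\<open>'n + 'n\<close>, where \<open>Inl t\<close>
  stands for \<open>x\<^sub>t\<close> and \<open>Inr t\<close> for \<open>y\<^sub>t\<close>. The form is defined for coordinate families in any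
  commutative ring, so that it applies both to vectors over \<open>k\<close> and to the indeterminate vectors.
\<close>

definition qform :: "('n::finite + 'n \<Rightarrow> 'a::comm_ring_1) \<Rightarrow> 'a" where
  "qform v = (\<Sum>t\<in>UNIV. v (Inl t) * v (Inr t))"

definition polar :: "('n::finite + 'n \<Rightarrow> 'a::comm_ring_1) \<Rightarrow> ('n + 'n \<Rightarrow> 'a) \<Rightarrow> 'a" where
  "polar v w = qform (\<lambda>c. v c + w c) - qform v - qform w"

lemma polar_eq: "polar v w = (\<Sum>t\<in>UNIV. v (Inl t) * w (Inr t) + v (Inr t) * w (Inl t))"
  by (simp add: polar_def qform_def algebra_simps sum.distrib)

definition orth_group :: "('k::field ^ ('n::finite + 'n) \<Rightarrow> 'k ^ ('n + 'n)) set" where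
  "orth_group = {g. Vector_Spaces.linear (*s) (*s) g \<and> bij g \<and>
                    (\<forall>v. qform (($) (g v)) = qform (($) v))}"


section \<open>Polynomials in several vectors and their invariants\<close>

text \<open>The variable \<open>(c, i)\<close> is the coordinate \<open>c\<close> of the \<open>i\<close>-th indeterminate vector.\<close>

type_synonym 'n coord = "('n + 'n) \<times> nat"

definition ivec :: "nat \<Rightarrow> 'n + 'n \<Rightarrow> ('n coord, 'k::comm_ring_1) mpoly" where
  "ivec i c = Var (c, i)"

definition R_alg :: "nat \<Rightarrow> ('n coord, 'k::comm_ring_1) mpoly set" where
  "R_alg m = polys_in (UNIV \<times> {1..m})"

text \<open>The left action \<open>(g p)(v\<^sup>1, \<dots>, v\<^sup>m) = p (g\<inverse> v\<^sup>1, \<dots>, g\<inverse> v\<^sup>m)\<close>.\<close>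

definition orth_act ::
    "('k::field ^ ('n::finite + 'n) \<Rightarrow> 'k ^ ('n + 'n)) \<Rightarrow> ('n coord, 'k) mpoly \<Rightarrow> ('n coord, 'k) mpoly" where
  "orth_act g = mpoly_subst (\<lambda>(c, i). \<Sum>d\<in>UNIV. Const (matrix (inv g) $ c $ d) * ivec i d)"

definition orth_invariants :: "nat \<Rightarrow> ('n::finite coord, 'k::field) mpoly set" where
  "orth_invariants m = {p \<in> R_alg m. \<forall>g\<in>orth_group. orth_act g p = p}"

definition Qpoly :: "nat \<Rightarrow> ('n::finite coord, 'k::comm_ring_1) mpoly" where
  "Qpoly i = qform (ivec i)"

definition Bpoly :: "nat \<Rightarrow> nat \<Rightarrow> ('n::finite coord, 'k::comm_ring_1) mpoly" where
  "Bpoly i j = polar (ivec i) (ivec j)"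

datatype QB_var = QV nat | BV nat nat

fun QB_value :: "QB_var \<Rightarrow> ('n::finite coord, 'k::comm_ring_1) mpoly" where
  "QB_value (QV i) = Qpoly i"
| "QB_value (BV i j) = Bpoly i j"

definition expressible_in_QB :: "nat \<Rightarrow> ('n::finite coord, 'k::comm_ring_1) mpoly \<Rightarrow> bool" where
  "expressible_in_QB m p \<longleftrightarrow>
     (\<exists>P \<in> polys_in (QV ` {1..m} \<union> {BV i j | i j. i \<in> {1..m} \<and> j \<in> {1..m}}).
        p = mpoly_subst QB_value P)"


section \<open>The polynomial given by prescribed monomial types\<close>

definition multilinear_in :: "nat set \<Rightarrow> 'n::finite coord monomial \<Rightarrow> bool" where
  "multilinear_in I mon \<longleftrightarrow> (\<forall>i\<in>I. (\<Sum>c\<in>UNIV. Poly_Mapping.lookup mon (c, i)) = 1)"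

text \<open>The two rows of the type of a monomial; factors are counted with multiplicity.\<close>

definition type_x :: "'n coord monomial \<Rightarrow> 'n \<Rightarrow> nat" where
  "type_x mon t = (\<Sum>(c, i)\<in>Poly_Mapping.keys mon \<inter> {Inl t} \<times> UNIV. Poly_Mapping.lookup mon (c, i))"

definition type_y :: "'n coord monomial \<Rightarrow> 'n \<Rightarrow> nat" where
  "type_y mon t = (\<Sum>(c, i)\<in>Poly_Mapping.keys mon \<inter> {Inr t} \<times> UNIV. Poly_Mapping.lookup mon (c, i))"

definition perm_2_3s :: "('n::finite \<Rightarrow> nat) \<Rightarrow> bool" where
  "perm_2_3s r \<longleftrightarrow>
     image_mset r (mset_set UNIV) = add_mset 2 (replicate_mset (CARD('n) - 1) 3)"

definition f_monomials :: "'n::finite coord monomial set" where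
  "f_monomials = {mon.
     Poly_Mapping.keys mon \<subseteq> UNIV \<times> {1..2 * (3 * CARD('n) - 1)} \<and>
     multilinear_in {1..2 * (3 * CARD('n) - 1)} mon \<and>
     type_x mon = type_y mon \<and> perm_2_3s (type_x mon) \<and> perm_2_3s (type_y mon)}"

definition f_poly :: "('n::finite coord, 'k::comm_ring_1) mpoly" where
  "f_poly = (\<Sum>mon\<in>f_monomials. Poly_Mapping.single mon 1)"

lemma finite_f_monomials: "finite (f_monomials :: 'n::finite coord monomial set)"
proof -
  let ?N = "2 * (3 * CARD('n) - 1)"
  have le1: "Poly_Mapping.lookup mon x \<le> 1"
    if "mon \<in> f_monomials" for mon :: "'n coord monomial" and x
  proof (cases "x \<in> Poly_Mapping.keys mon")
    case True
    obtain c i where x: "x = (c, i)" by (cases x)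
    have "i \<in> {1..?N}"
      using True that x unfolding f_monomials_def by blast
    then have "(\<Sum>c\<in>UNIV. Poly_Mapping.lookup mon (c, i)) = 1"
      using that unfolding f_monomials_def multilinear_in_def by blast
    moreover have "Poly_Mapping.lookup mon (c, i) \<le> (\<Sum>c\<in>UNIV. Poly_Mapping.lookup mon (c, i))"
      by (rule member_le_sum) auto
    ultimately show ?thesis using x by simp
  qed (simp add: in_keys_iff)
  have "inj_on Poly_Mapping.keys (f_monomials :: 'n coord monomial set)"
  proof (rule inj_onI, rule poly_mapping_eqI)
    fix a b :: "'n coord monomial" and x
    assume ab: "a \<in> f_monomials" "b \<in> f_monomials"
      and "Poly_Mapping.keys a = Poly_Mapping.keys b"
    then have "Poly_Mapping.lookup a x \<noteq> 0 \<longleftrightarrow> Poly_Mapping.lookup b x \<noteq> 0"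
      by (metis in_keys_iff)
    then show "Poly_Mapping.lookup a x = Poly_Mapping.lookup b x"
      using le1[OF ab(1), of x] le1[OF ab(2), of x] by linarith
  qed
  moreover have "Poly_Mapping.keys ` (f_monomials :: 'n coord monomial set)
      \<subseteq> Pow (UNIV \<times> {1..?N})"
    unfolding f_monomials_def by blast
  ultimately show ?thesis
    by (meson finite_Pow_iff finite_SigmaI finite_atLeastAtMost finite_imageD finite_subset finite)
qed

end

theory Submission
  imports Defs "HOL-Analysis.Determinants"
begin

text \<open>
  Write \<open>N = 2 (3 \<nu> - 1)\<close>. Attach to every vector \<open>v\<^sup>i\<close> the linear form \<open>L\<^sub>i = \<Sum>\<^sub>c v\<^sup>i\<^sub>c X\<^sub>c\<close> in \<open>2 \<nu>\<close> auxiliary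
  variables, and let \<open>q\<close> be the quadratic form in these variables. The type condition says precisely
  that a monomial becomes \<open>\<Prod>\<^sub>c X\<^sub>c\<^sup>3\<close> after multiplication by one term \<open>X\<^sub>t Y\<^sub>t\<close> of \<open>q\<close>. Hence the polynomial
  is the coefficient of \<open>\<Prod>\<^sub>c X\<^sub>c\<^sup>3\<close> in \<open>q L\<^sub>1 \<cdots> L\<^sub>N\<close> (lemma \<open>multilinear_form_eq_top_coefficient\<close>).

  Invariance follows because this coefficient has an intrinsic meaning in characteristic 2. Fourth
  powers are additive, so the ideal generated by all \<open>X\<^sub>c\<^sup>4\<close> is stable under every linear substitution.
  The quotient has one-dimensional top degree \<open>6 \<nu> = N + 2\<close>, spanned by \<open>\<Prod>\<^sub>c X\<^sub>c\<^sup>3\<close>, on which a substitution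
  acts by the cube of its determinant, so trivially if the determinant is 1 (\<open>prod_linear_subst_cube\<close>, \<open>homogeneous_linear_subst\<close>). An orthogonal
  transformation moves the \<open>L\<^sub>i\<close> by a substitution that fixes \<open>q\<close> and has determinant 1
  (\<open>orth_transpose_inv_qform\<close>, \<open>orth_det_inv\<close>), so the coefficient stays the same.

  For the second claim the vectors are specialized. The vectors \<open>2, 3, 4\<close> become multiples
  \<open>z\<^sub>i (\<delta> e\<^sub>x + e\<^sub>y)\<close> of one vector in a hyperbolic plane, the first becomes \<open>e\<^sub>x\<close> in the same plane, and the
  remaining ones become basis vectors of the other planes. Then all \<open>Q\<close> and \<open>B\<close> take values in the
  ring spanned by the monomials with at least as many disjoint squares \<open>z\<^sub>i\<^sup>2\<close> as factors \<open>\<delta>\<close>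
  (\<open>expressible_test_value\<close>). The polynomial itself takes the value
  \<open>3 \<delta> z\<^sub>2 z\<^sub>3 z\<^sub>4 = \<delta> z\<^sub>2 z\<^sub>3 z\<^sub>4\<close> (\<open>multilinear_form_test_vector\<close>), which is not in that ring.
\<close>

section \<open>Substitution is a ring homomorphism\<close>

lemma Const_add: "Const (a + b) = Const a + Const b"
  by (simp add: Const_def single_add)

lemma Const_mult: "Const (a * b) = (Const a * Const b :: ('v, 'a::comm_ring_1) mpoly)"
  by (simp add: Const_def mult_single)

lemma Const_0 [simp]: "Const 0 = 0"
  by (simp add: Const_def)

lemma Const_1 [simp]: "Const 1 = (1 :: ('v, 'a::comm_ring_1) mpoly)"
  by (simp add: Const_def single_one)

lemma Const_sum: "Const (sum f A) = (\<Sum>x\<in>A. Const (f x))"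
  by (induction A rule: infinite_finite_induct) (simp_all add: Const_add)

lemma Const_prod: "Const (prod f A) = (\<Prod>x\<in>A. Const (f x) :: ('v, 'a::comm_ring_1) mpoly)"
  by (induction A rule: infinite_finite_induct) (simp_all add: Const_mult)

lemma sum_singles_keys:
  "(\<Sum>k\<in>Poly_Mapping.keys p. Poly_Mapping.single k (Poly_Mapping.lookup p k)) = p"
  by (rule poly_mapping_eqI) (simp add: lookup_sum lookup_single when_def in_keys_iff)

lemma mpoly_two_eq_0:
  assumes "(2::'a::comm_ring_1) = 0"
  shows "(2 :: ('v, 'a) mpoly) = 0"
  using single_numeral[of "Num.Bit0 Num.One", where 'a = "'v monomial" and 'b = 'a] assms by simp

definition monomial_value :: "('w \<Rightarrow> 'r::comm_ring_1) \<Rightarrow> 'w monomial \<Rightarrow> 'r" where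
  "monomial_value s mon = (\<Prod>x\<in>Poly_Mapping.keys mon. s x ^ Poly_Mapping.lookup mon x)"

lemma monomial_value_superset:
  assumes "finite A" "Poly_Mapping.keys mon \<subseteq> A"
  shows "monomial_value s mon = (\<Prod>x\<in>A. s x ^ Poly_Mapping.lookup mon x)"
  unfolding monomial_value_def using assms
  by (intro prod.mono_neutral_left) (auto simp: in_keys_iff)

lemma monomial_value_0 [simp]: "monomial_value s 0 = 1"
  by (simp add: monomial_value_def)

lemma monomial_value_add:
  "monomial_value s (a + b) = monomial_value s a * monomial_value s b"
proof -
  let ?A = "Poly_Mapping.keys a \<union> Poly_Mapping.keys b"
  have "Poly_Mapping.keys (a + b) \<subseteq> ?A"
    by (rule keys_add)
  then show ?thesis
    by (simp add: monomial_value_superset[of ?A] lookup_add power_add prod.distrib)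
qed

lemma mpoly_subst_superset:
  assumes "finite M" "Poly_Mapping.keys p \<subseteq> M"
  shows "mpoly_subst s p = (\<Sum>mon\<in>M. Const (Poly_Mapping.lookup p mon) * monomial_value s mon)"
  unfolding mpoly_subst_def monomial_value_def using assms
  by (intro sum.mono_neutral_left) (auto simp: in_keys_iff)

lemma mpoly_subst_add: "mpoly_subst s (p + q) = mpoly_subst s p + mpoly_subst s q"
proof -
  let ?M = "Poly_Mapping.keys p \<union> Poly_Mapping.keys q"
  have "Poly_Mapping.keys (p + q) \<subseteq> ?M"
    by (rule keys_add)
  then show ?thesis
    by (simp add: mpoly_subst_superset[of ?M] lookup_add Const_add distrib_right sum.distrib)
qed

lemma mpoly_subst_0 [simp]: "mpoly_subst s 0 = 0"
  by (simp add: mpoly_subst_def)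

lemma mpoly_subst_1 [simp]: "mpoly_subst s 1 = 1"
  using mpoly_subst_Const[of s 1] by simp

lemma mpoly_subst_sum: "mpoly_subst s (sum f A) = (\<Sum>x\<in>A. mpoly_subst s (f x))"
  by (induction A rule: infinite_finite_induct) (simp_all add: mpoly_subst_add)

lemma mpoly_subst_single:
  "mpoly_subst s (Poly_Mapping.single mon c) = Const c * monomial_value s mon"
  by (cases "c = 0") (simp_all add: mpoly_subst_def monomial_value_def)

lemma mpoly_subst_mult: "mpoly_subst s (p * q) = mpoly_subst s p * mpoly_subst s q"
proof -
  have "mpoly_subst s (p * q) = mpoly_subst s
      ((\<Sum>k\<in>Poly_Mapping.keys p. Poly_Mapping.single k (Poly_Mapping.lookup p k)) *
       (\<Sum>k\<in>Poly_Mapping.keys q. Poly_Mapping.single k (Poly_Mapping.lookup q k)))"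
    by (simp only: sum_singles_keys)
  also have "\<dots> = mpoly_subst s
        (\<Sum>k\<in>Poly_Mapping.keys p. Poly_Mapping.single k (Poly_Mapping.lookup p k)) *
      mpoly_subst s (\<Sum>k\<in>Poly_Mapping.keys q. Poly_Mapping.single k (Poly_Mapping.lookup q k))"
    by (simp add: sum_product mpoly_subst_sum mpoly_subst_single mult_single monomial_value_add
        Const_mult mult_ac)
  finally show ?thesis
    by (simp only: sum_singles_keys)
qed

lemma mpoly_subst_prod: "mpoly_subst s (prod f A) = (\<Prod>x\<in>A. mpoly_subst s (f x))"
  by (induction A rule: infinite_finite_induct) (simp_all add: mpoly_subst_mult)

lemma mpoly_subst_power: "mpoly_subst s (p ^ n) = mpoly_subst s p ^ n"
  by (induction n) (simp_all add: mpoly_subst_mult)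

section \<open>Monomials with a high exponent\<close>

text \<open>The ideal generated by the \<open>n\<close>-th powers of all variables. For \<open>n = 4\<close> the quotient is a truncated
  polynomial ring whose top degree is spanned by the product of the cubes of the variables.\<close>

definition high_power_ideal :: "nat \<Rightarrow> ('v, 'a::comm_ring_1) mpoly set" where
  "high_power_ideal n =
     {p. \<forall>mon\<in>Poly_Mapping.keys p. \<exists>v. n \<le> Poly_Mapping.lookup mon v}"

lemma high_power_ideal_0 [simp]: "0 \<in> high_power_ideal n"
  by (simp add: high_power_ideal_def)

lemma high_power_ideal_add:
  assumes "p \<in> high_power_ideal n" "q \<in> high_power_ideal n"
  shows "p + q \<in> high_power_ideal n"
  using assms keys_add[of p q] unfolding high_power_ideal_def by blast

lemma high_power_ideal_sum:
  assumes "\<And>x. x \<in> A \<Longrightarrow> f x \<in> high_power_ideal n"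
  shows "sum f A \<in> high_power_ideal n"
  using assms
  by (induction A rule: infinite_finite_induct) (simp_all add: high_power_ideal_add)

lemma high_power_ideal_mult:
  assumes "q \<in> high_power_ideal n"
  shows "p * q \<in> high_power_ideal n"
  unfolding high_power_ideal_def
proof safe
  fix mon assume "mon \<in> Poly_Mapping.keys (p * q)"
  then obtain a b where "mon = a + b" "b \<in> Poly_Mapping.keys q"
    using keys_mult[of p q] by blast
  moreover then obtain v where "n \<le> Poly_Mapping.lookup b v"
    using assms unfolding high_power_ideal_def by blast
  ultimately show "\<exists>v. n \<le> Poly_Mapping.lookup mon v"
    by (metis lookup_add trans_le_add2)
qed

lemma high_power_ideal_diff:
  assumes "p \<in> high_power_ideal n" "q \<in> high_power_ideal n"
  shows "p - q \<in> high_power_ideal n"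
  using high_power_ideal_add[OF assms(1) high_power_ideal_mult[OF assms(2), of "- 1"]] by simp

lemma high_power_ideal_single:
  assumes "n \<le> Poly_Mapping.lookup mon v"
  shows "Poly_Mapping.single mon c \<in> high_power_ideal n"
  using assms by (auto simp: high_power_ideal_def)

lemma high_power_ideal_lookup:
  assumes "p \<in> high_power_ideal n" "\<And>v. Poly_Mapping.lookup mon v < n"
  shows "Poly_Mapping.lookup p mon = 0"
proof (rule ccontr)
  assume "Poly_Mapping.lookup p mon \<noteq> 0"
  then have "mon \<in> Poly_Mapping.keys p"
    by (simp add: in_keys_iff)
  then obtain v where "n \<le> Poly_Mapping.lookup mon v"
    using assms(1) unfolding high_power_ideal_def by blast
  then show False using assms(2)[of v] by simp
qed

lemma square_sum_char2:
  fixes f :: "'i \<Rightarrow> 'r::comm_ring_1"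
  assumes "(2::'r) = 0"
  shows "(sum f A)\<^sup>2 = (\<Sum>x\<in>A. (f x)\<^sup>2)"
  by (induction A rule: infinite_finite_induct) (simp_all add: power2_sum assms)

text \<open>In characteristic 2 squaring is additive, so it doubles the exponents of each monomial
  separately and creates no mixed terms.\<close>

lemma high_power_ideal_square:
  fixes p :: "('v, 'a::comm_ring_1) mpoly"
  assumes "(2::'a) = 0" "p \<in> high_power_ideal n"
  shows "p\<^sup>2 \<in> high_power_ideal (2 * n)"
proof -
  have "p\<^sup>2 = (\<Sum>k\<in>Poly_Mapping.keys p. Poly_Mapping.single k (Poly_Mapping.lookup p k))\<^sup>2"
    by (simp only: sum_singles_keys)
  also have "\<dots> = (\<Sum>k\<in>Poly_Mapping.keys p. (Poly_Mapping.single k (Poly_Mapping.lookup p k))\<^sup>2)"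
    by (rule square_sum_char2[OF mpoly_two_eq_0[OF assms(1)]])
  also have "\<dots> \<in> high_power_ideal (2 * n)"
  proof (rule high_power_ideal_sum)
    fix k assume "k \<in> Poly_Mapping.keys p"
    then obtain v where "n \<le> Poly_Mapping.lookup k v"
      using assms(2) unfolding high_power_ideal_def by blast
    then have "2 * n \<le> Poly_Mapping.lookup (k + k) v"
      by (simp add: lookup_add)
    then show "(Poly_Mapping.single k (Poly_Mapping.lookup p k))\<^sup>2 \<in> high_power_ideal (2 * n)"
      by (simp add: power2_eq_square mult_single high_power_ideal_single)
  qed
  finally show ?thesis .
qed

section \<open>Linear substitutions modulo fourth powers\<close>

text \<open>The images of the variables under the algebra endomorphism that acts on the span of the variables
  by the matrix \<open>A\<close>.\<close>

definition linear_subst :: "'a::comm_ring_1 ^ 'c ^ 'c \<Rightarrow> 'c::finite \<Rightarrow> ('c, 'a) mpoly" where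
  "linear_subst A x = (\<Sum>c\<in>UNIV. Const (A $ c $ x) * Var c)"

text \<open>The fourth power is additive in characteristic 2, so linear substitutions preserve the ideal of
  fourth powers. This is what makes the truncated polynomial ring a representation of the whole
  general linear group.\<close>

lemma linear_subst_power4:
  assumes "(2::'a::comm_ring_1) = 0"
  shows "linear_subst (A :: 'a ^ 'c::finite ^ 'c) x ^ 4 \<in> high_power_ideal 4"
proof -
  have "linear_subst A x \<in> high_power_ideal 1"
    unfolding linear_subst_def Var_def
  proof (intro high_power_ideal_sum high_power_ideal_mult)
    fix c :: 'c
    show "Poly_Mapping.single (Poly_Mapping.single c 1) 1 \<in> high_power_ideal 1"
      by (rule high_power_ideal_single[where v = c]) simp
  qed
  from high_power_ideal_square[OF assms high_power_ideal_square[OF assms this]]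
  have "((linear_subst A x)\<^sup>2)\<^sup>2 \<in> high_power_ideal (2 * (2 * 1))" .
  moreover have "((linear_subst A x)\<^sup>2)\<^sup>2 = linear_subst A x ^ 4"
    using power_mult[of "linear_subst A x" 2 2] by simp
  ultimately show ?thesis by (simp only: mult_1_right) simp
qed

lemma prod_Var_image: "(\<Prod>x\<in>A. Var (f x)) =
    Poly_Mapping.single (\<Sum>x\<in>A. Poly_Mapping.single (f x) 1) (1::'a::comm_ring_1)"
  by (induction A rule: infinite_finite_induct) (simp_all add: Var_def mult_single)

lemma lookup_sum_singles:
  assumes "finite A"
  shows "Poly_Mapping.lookup (\<Sum>x\<in>A. Poly_Mapping.single (f x) (1::nat)) c = card {x\<in>A. f x = c}"
  by (simp add: lookup_sum lookup_single when_def assms sum.If_cases Int_def)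

lemma lookup_sum_singles_id:
  "Poly_Mapping.lookup (\<Sum>x\<in>UNIV. Poly_Mapping.single (x::'c::finite) (1::nat)) v = 1"
  by (simp add: lookup_sum lookup_single when_def)

text \<open>In characteristic 2 determinants are permanents, and permanents are what expanding a product of
  linear forms produces.\<close>

lemma det_char2:
  assumes "(2::'a::comm_ring_1) = 0"
  shows "det (A :: 'a ^ 'c::finite ^ 'c) = (\<Sum>p | p permutes UNIV. \<Prod>x\<in>UNIV. A $ (p x) $ x)"
proof -
  have "(-1::'a) = 1"
    using assms by (metis add.inverse_unique one_add_one)
  then have "of_int (sign p) = (1::'a)" for p :: "'c \<Rightarrow> 'c"
    by (simp add: sign_def)
  then have "det (transpose A) = (\<Sum>p | p permutes UNIV. \<Prod>x\<in>UNIV. A $ (p x) $ x)"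
    unfolding det_def by (simp add: transpose_def)
  then show ?thesis by simp
qed

text \<open>Expanding the product over all maps \<open>\<phi>\<close> of the index set to itself, the permutations contribute
  the determinant, and a map that is not injective contributes a multiple of a square.\<close>

lemma prod_linear_subst:
  assumes "(2::'a::comm_ring_1) = 0"
  shows "(\<Prod>x\<in>UNIV. linear_subst (A :: 'a ^ 'c::finite ^ 'c) x) - Const (det A) * (\<Prod>x\<in>UNIV. Var x)
     \<in> high_power_ideal 2"
proof -
  let ?t = "\<lambda>\<phi>. Const (\<Prod>x\<in>UNIV. A $ (\<phi> x) $ x) * (\<Prod>x\<in>UNIV. Var (\<phi> x)) :: ('c, 'a) mpoly"
  have "(\<Prod>x\<in>UNIV. linear_subst A x) = (\<Sum>\<phi>\<in>UNIV. ?t \<phi>)"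
    unfolding linear_subst_def
    by (subst prod_sum_PiE) (simp_all add: PiE_UNIV_domain prod.distrib Const_prod)
  also have "\<dots> = (\<Sum>\<phi> | \<phi> permutes UNIV. ?t \<phi>) + (\<Sum>\<phi> | \<not> \<phi> permutes UNIV. ?t \<phi>)"
    by (subst sum.union_disjoint[symmetric]) (auto intro!: sum.cong)
  also have "(\<Sum>\<phi> | \<phi> permutes UNIV. ?t \<phi>) = Const (det A) * (\<Prod>x\<in>UNIV. Var x)"
  proof -
    have "(\<Prod>x\<in>UNIV. Var (\<phi> x)) = (\<Prod>x\<in>UNIV. Var x :: ('c, 'a) mpoly)" if "\<phi> permutes UNIV" for \<phi>
      using prod.permute[OF that, of "Var :: 'c \<Rightarrow> ('c, 'a) mpoly"] by (simp add: comp_def)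
    then show ?thesis
      by (simp add: det_char2[OF assms] Const_sum sum_distrib_right)
  qed
  finally have "(\<Prod>x\<in>UNIV. linear_subst A x) - Const (det A) * (\<Prod>x\<in>UNIV. Var x) =
      (\<Sum>\<phi> | \<not> \<phi> permutes UNIV. ?t \<phi>)"
    by simp
  also have "\<dots> \<in> high_power_ideal 2"
  proof (intro high_power_ideal_sum high_power_ideal_mult)
    fix \<phi> :: "'c \<Rightarrow> 'c" assume "\<phi> \<in> {\<phi>. \<not> \<phi> permutes UNIV}"
    then have "\<not> inj \<phi>"
      using bij_imp_permutes[of \<phi> UNIV] finite_UNIV_inj_surj[of \<phi>] by (auto simp: bij_def)
    then obtain x y where "x \<noteq> y" "\<phi> x = \<phi> y"
      unfolding inj_def by blast
    then have "card {x, y} \<le> card {z. \<phi> z = \<phi> x}"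
      by (intro card_mono) auto
    then have "2 \<le> Poly_Mapping.lookup (\<Sum>x\<in>UNIV. Poly_Mapping.single (\<phi> x) (1::nat)) (\<phi> x)"
      using \<open>x \<noteq> y\<close> by (simp add: lookup_sum_singles del: One_nat_def)
    then show "(\<Prod>x\<in>UNIV. Var (\<phi> x)) \<in> high_power_ideal 2"
      unfolding prod_Var_image by (rule high_power_ideal_single)
  qed
  finally show ?thesis .
qed

text \<open>A linear substitution acts on the top degree of the truncated polynomial ring by \<open>det\<^sup>3\<close>, so
  trivially for determinant 1. The cube is handled as the product times its square: if \<open>P = Z + r\<close> with \<open>r\<close> in the ideal of squares,
  then \<open>P\<^sup>3 = P (Z\<^sup>2 + r\<^sup>2)\<close>, where \<open>r\<^sup>2\<close> lies in the ideal of fourth powers and so does \<open>Z\<^sup>2 r\<close>.\<close>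

lemma prod_linear_subst_cube:
  assumes two: "(2::'a::comm_ring_1) = 0" and det: "det (A :: 'a ^ 'c::finite ^ 'c) = 1"
  shows "(\<Prod>x\<in>UNIV. linear_subst A x) ^ 3 - (\<Prod>x\<in>UNIV. Var x) ^ 3 \<in> high_power_ideal 4"
proof -
  define P Z where "P = (\<Prod>x\<in>UNIV. linear_subst A x)" and "Z = (\<Prod>x\<in>UNIV. Var x :: ('c, 'a) mpoly)"
  define r where "r = P - Z"
  have r: "r \<in> high_power_ideal 2"
    using prod_linear_subst[OF two, of A] det by (simp add: r_def P_def Z_def)
  have r2: "r\<^sup>2 \<in> high_power_ideal 4"
    using high_power_ideal_square[OF two r] by simp
  have Zr: "Z\<^sup>2 * r \<in> high_power_ideal 4"
  proof -
    have "Z\<^sup>2 * r = (\<Sum>k\<in>Poly_Mapping.keys r. Z\<^sup>2 * Poly_Mapping.single k (Poly_Mapping.lookup r k))"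
      by (simp only: sum_singles_keys flip: sum_distrib_left)
    also have "\<dots> \<in> high_power_ideal 4"
    proof (rule high_power_ideal_sum)
      fix k assume "k \<in> Poly_Mapping.keys r"
      then obtain v where v: "2 \<le> Poly_Mapping.lookup k v"
        using r unfolding high_power_ideal_def by blast
      let ?e = "\<Sum>x\<in>UNIV. Poly_Mapping.single (x::'c) (1::nat)"
      have "4 \<le> Poly_Mapping.lookup (?e + ?e + k) v"
        using v by (simp only: lookup_add lookup_sum_singles_id)
      then show "Z\<^sup>2 * Poly_Mapping.single k (Poly_Mapping.lookup r k) \<in> high_power_ideal 4"
        unfolding Z_def power2_eq_square prod_Var_image mult_single by (rule high_power_ideal_single)
    qed
    finally show ?thesis .
  qed
  have "P ^ 3 - Z ^ 3 = Z\<^sup>2 * r + P * r\<^sup>2"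
  proof -
    have P: "P = Z + r" by (simp add: r_def)
    have "P\<^sup>2 = Z\<^sup>2 + r\<^sup>2"
      unfolding P by (simp add: power2_sum mpoly_two_eq_0[OF two])
    then have "P ^ 3 = P * (Z\<^sup>2 + r\<^sup>2)"
      by (simp add: power3_eq_cube power2_eq_square mult.assoc)
    then show ?thesis
      by (simp add: P algebra_simps power3_eq_cube power2_eq_square)
  qed
  then show ?thesis
    unfolding P_def[symmetric] Z_def[symmetric]
    using high_power_ideal_add[OF Zr high_power_ideal_mult[OF r2, of P]] by simp
qed

text \<open>In this degree either all exponents are 3, which is the case above, or some exponent is at least 4,
  and then the monomial and its image both vanish in the truncated ring.\<close>

lemma monomial_linear_subst:
  fixes A :: "'a::comm_ring_1 ^ 'c::finite ^ 'c"
  assumes two: "(2::'a) = 0" and det: "det A = 1"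
    and deg: "(\<Sum>c\<in>UNIV. Poly_Mapping.lookup mon c) = 3 * CARD('c)"
  shows "monomial_value (linear_subst A) mon - Poly_Mapping.single mon 1 \<in> high_power_ideal 4"
proof (cases "\<exists>c. 4 \<le> Poly_Mapping.lookup mon c")
  case True
  then obtain c where c: "4 \<le> Poly_Mapping.lookup mon c" by blast
  then have "c \<in> Poly_Mapping.keys mon" by (auto simp: in_keys_iff)
  define q where "q = (\<Prod>x\<in>Poly_Mapping.keys mon - {c}. linear_subst A x ^ Poly_Mapping.lookup mon x)"
  have q: "monomial_value (linear_subst A) mon = q * linear_subst A c ^ Poly_Mapping.lookup mon c"
    unfolding monomial_value_def q_def prod.remove[OF finite_keys \<open>c \<in> _\<close>] by (rule mult.commute)
  have "linear_subst A c ^ Poly_Mapping.lookup mon c =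
      linear_subst A c ^ (Poly_Mapping.lookup mon c - 4) * linear_subst A c ^ 4"
    using c by (simp flip: power_add)
  then show ?thesis
    unfolding q using c
    by (intro high_power_ideal_diff high_power_ideal_single)
      (simp_all add: high_power_ideal_mult linear_subst_power4[OF two])
next
  case False
  have le: "Poly_Mapping.lookup mon c \<le> 3" for c
  proof -
    have "\<not> 4 \<le> Poly_Mapping.lookup mon c"
      using False by blast
    then show ?thesis by linarith
  qed
  have eq: "Poly_Mapping.lookup mon c = 3" for c
  proof (rule ccontr)
    assume "Poly_Mapping.lookup mon c \<noteq> 3"
    then have "(\<Sum>c\<in>UNIV. Poly_Mapping.lookup mon c) < (\<Sum>c\<in>(UNIV::'c set). 3)"
      using le by (intro sum_strict_mono_ex1) (auto simp: le_less)
    then show False using deg by simp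
  qed
  have "Poly_Mapping.single mon (1::'a) = (\<Prod>x\<in>UNIV. Var x) ^ 3"
  proof -
    let ?e = "\<Sum>x\<in>UNIV. Poly_Mapping.single (x::'c) (1::nat)"
    have "mon = ?e + ?e + ?e"
      by (intro poly_mapping_eqI) (simp only: eq lookup_add lookup_sum_singles_id)
    then show ?thesis
      by (simp add: power3_eq_cube prod_Var_image mult_single)
  qed
  moreover have "monomial_value (linear_subst A) mon = (\<Prod>x\<in>UNIV. linear_subst A x) ^ 3"
    by (simp add: monomial_value_superset[of UNIV] eq prod_power_distrib)
  ultimately show ?thesis
    using prod_linear_subst_cube[OF two det] by simp
qed

lemma homogeneous_linear_subst:
  fixes A :: "'a::comm_ring_1 ^ 'c::finite ^ 'c"
  assumes two: "(2::'a) = 0" and det: "det A = 1"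
    and deg: "\<And>mon. mon \<in> Poly_Mapping.keys p \<Longrightarrow>
      (\<Sum>c\<in>UNIV. Poly_Mapping.lookup mon c) = 3 * CARD('c)"
    and m3: "\<And>c. Poly_Mapping.lookup mon3 c = 3"
  shows "Poly_Mapping.lookup (mpoly_subst (linear_subst A) p) mon3 = Poly_Mapping.lookup p mon3"
proof -
  have "mpoly_subst (linear_subst A) p - p = (\<Sum>mon\<in>Poly_Mapping.keys p.
      Const (Poly_Mapping.lookup p mon) *
        (monomial_value (linear_subst A) mon - Poly_Mapping.single mon 1))"
  proof -
    have "p = (\<Sum>mon\<in>Poly_Mapping.keys p.
        Const (Poly_Mapping.lookup p mon) * Poly_Mapping.single mon 1)"
      by (simp add: Const_def mult_single sum_singles_keys)
    then show ?thesis
      by (simp add: mpoly_subst_superset[of "Poly_Mapping.keys p"] right_diff_distrib sum_subtractf)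
  qed
  also have "\<dots> \<in> high_power_ideal 4"
    by (intro high_power_ideal_sum high_power_ideal_mult monomial_linear_subst two det deg)
  finally have "Poly_Mapping.lookup (mpoly_subst (linear_subst A) p - p) mon3 = 0"
    by (rule high_power_ideal_lookup) (simp add: m3)
  then show ?thesis by (simp add: lookup_minus)
qed

section \<open>The polynomial as a multilinear form\<close>

definition top_monomial :: "'c::finite monomial" where
  "top_monomial = (\<Sum>c\<in>UNIV. Poly_Mapping.single c 3)"

lemma lookup_top_monomial [simp]: "Poly_Mapping.lookup top_monomial c = 3"
  by (simp add: top_monomial_def lookup_sum lookup_single when_def)

text \<open>One more factor \<open>x\<^sub>t y\<^sub>t\<close> brings all counts up to exactly 3. This reformulates the condition on
  the type so that it becomes a coefficient extraction.\<close>

definition balanced :: "('n + 'n \<Rightarrow> nat) \<Rightarrow> 'n \<Rightarrow> bool" where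
  "balanced r t \<longleftrightarrow> (\<forall>c. r c + (if c = Inl t \<or> c = Inr t then 1 else 0) = 3)"

text \<open>A multilinear monomial picks one coordinate of each vector; a labelling records the choices.\<close>

definition labellings :: "(nat \<Rightarrow> 'n::finite + 'n) set" where
  "labellings = {l \<in> {1..2 * (3 * CARD('n) - 1)} \<rightarrow>\<^sub>E UNIV.
     \<exists>t. balanced (\<lambda>c. card {i \<in> {1..2 * (3 * CARD('n) - 1)}. l i = c}) t}"

text \<open>The polynomial in question, evaluated at vectors with entries in an arbitrary commutative ring. Both
  the group action and the specialization of the vectors amount to changing the argument \<open>u\<close>.\<close>

definition multilinear_form :: "(nat \<Rightarrow> 'n::finite + 'n \<Rightarrow> 'r::comm_ring_1) \<Rightarrow> 'r" where
  "multilinear_form u = (\<Sum>l\<in>labellings. \<Prod>i\<in>{1..2 * (3 * CARD('n) - 1)}. u i (l i))"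

lemma perm_2_3s_iff:
  fixes r :: "'n::finite \<Rightarrow> nat"
  shows "perm_2_3s r \<longleftrightarrow> (\<exists>t. \<forall>s. r s + (if s = t then 1 else 0) = 3)"
proof
  assume p: "perm_2_3s r"
  then have "2 \<in># image_mset r (mset_set UNIV)"
    unfolding perm_2_3s_def by simp
  then obtain t where t: "r t = 2" by auto
  have "mset_set UNIV = add_mset t (mset_set (UNIV - {t}))"
    by (rule mset_set.remove) auto
  with p t have "image_mset r (mset_set (UNIV - {t})) = replicate_mset (CARD('n) - 1) 3"
    unfolding perm_2_3s_def by simp
  then have "set_mset (image_mset r (mset_set (UNIV - {t}))) \<subseteq> {3}"
    by (simp add: set_mset_replicate_mset_subset)
  then have "r s = 3" if "s \<noteq> t" for s
    using that by auto
  with t show "\<exists>t. \<forall>s. r s + (if s = t then 1 else 0) = 3"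
    by (intro exI[of _ t]) simp
next
  assume "\<exists>t. \<forall>s. r s + (if s = t then 1 else 0) = 3"
  then obtain t where t: "\<And>s. r s + (if s = t then 1 else 0) = 3" by blast
  have rt: "r t = 2" using t[of t] by simp
  have rs: "r s = 3" if "s \<noteq> t" for s using t[of s] that by simp
  have "mset_set UNIV = add_mset t (mset_set (UNIV - {t}))"
    by (rule mset_set.remove) auto
  moreover have "image_mset r (mset_set (UNIV - {t})) = image_mset (\<lambda>_. 3) (mset_set (UNIV - {t}))"
    by (rule image_mset_cong) (simp add: rs)
  ultimately show "perm_2_3s r"
    unfolding perm_2_3s_def by (simp add: rt image_mset_const_eq)
qed

definition labelling_monomial :: "(nat \<Rightarrow> 'n::finite + 'n) \<Rightarrow> 'n coord monomial" where
  "labelling_monomial l = (\<Sum>i\<in>{1..2 * (3 * CARD('n) - 1)}. Poly_Mapping.single (l i, i) 1)"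

lemma lookup_labelling_monomial:
  fixes l :: "nat \<Rightarrow> 'n::finite + 'n"
  shows "Poly_Mapping.lookup (labelling_monomial l) (c, i) =
    (if i \<in> {1..2 * (3 * CARD('n) - 1)} \<and> l i = c then 1 else 0)"
proof -
  let ?I = "{1..2 * (3 * CARD('n) - 1)}"
  have "{j \<in> ?I. (l j, j) = (c, i)} = (if i \<in> ?I \<and> l i = c then {i} else {})"
    by auto
  then show ?thesis
    unfolding labelling_monomial_def lookup_sum_singles[OF finite_atLeastAtMost]
    by simp
qed

lemma keys_labelling_monomial:
  fixes l :: "nat \<Rightarrow> 'n::finite + 'n"
  shows "Poly_Mapping.keys (labelling_monomial l) \<subseteq> UNIV \<times> {1..2 * (3 * CARD('n) - 1)}"
  by (auto simp: in_keys_iff lookup_labelling_monomial split: if_splits)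

lemma sum_keys_row:
  assumes "Poly_Mapping.keys mon \<subseteq> UNIV \<times> I" "finite I"
  shows "(\<Sum>(c, i)\<in>Poly_Mapping.keys mon \<inter> {a} \<times> UNIV. Poly_Mapping.lookup mon (c, i)) =
    (\<Sum>i\<in>I. Poly_Mapping.lookup mon (a, i))"
proof -
  have "(\<Sum>(c, i)\<in>Poly_Mapping.keys mon \<inter> {a} \<times> UNIV. Poly_Mapping.lookup mon (c, i)) =
      (\<Sum>(c, i)\<in>{a} \<times> I. Poly_Mapping.lookup mon (c, i))"
    using assms by (intro sum.mono_neutral_left) (auto simp: in_keys_iff)
  also have "\<dots> = (\<Sum>c\<in>{a}. \<Sum>i\<in>I. Poly_Mapping.lookup mon (c, i))"
    by (rule sum.cartesian_product[symmetric])
  finally show ?thesis by simp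
qed

lemma type_labelling_monomial:
  fixes l :: "nat \<Rightarrow> 'n::finite + 'n"
  shows "type_x (labelling_monomial l) t = card {i \<in> {1..2 * (3 * CARD('n) - 1)}. l i = Inl t}"
    and "type_y (labelling_monomial l) t = card {i \<in> {1..2 * (3 * CARD('n) - 1)}. l i = Inr t}"
  unfolding type_x_def type_y_def sum_keys_row[OF keys_labelling_monomial finite_atLeastAtMost]
  by (simp_all add: lookup_labelling_monomial sum.If_cases Int_def)

lemma balanced_iff_types:
  "(\<exists>t. balanced r t) \<longleftrightarrow>
    (\<lambda>t. r (Inl t)) = (\<lambda>t. r (Inr t)) \<and> perm_2_3s (\<lambda>t. r (Inl t)) \<and> perm_2_3s (\<lambda>t. r (Inr t))"
proof
  assume "\<exists>t. balanced r t"
  then obtain t where t: "\<And>c. r c + (if c = Inl t \<or> c = Inr t then 1 else 0) = 3"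
    unfolding balanced_def by blast
  have l: "r (Inl s) + (if s = t then 1 else 0) = 3" for s using t[of "Inl s"] by simp
  have r: "r (Inr s) + (if s = t then 1 else 0) = 3" for s using t[of "Inr s"] by simp
  have "r (Inl s) = r (Inr s)" for s using l[of s] r[of s] by simp
  moreover have "perm_2_3s (\<lambda>t. r (Inl t))" "perm_2_3s (\<lambda>t. r (Inr t))"
    unfolding perm_2_3s_iff using l r by blast+
  ultimately show "(\<lambda>t. r (Inl t)) = (\<lambda>t. r (Inr t)) \<and> perm_2_3s (\<lambda>t. r (Inl t)) \<and> perm_2_3s (\<lambda>t. r (Inr t))"
    by simp
next
  assume *: "(\<lambda>t. r (Inl t)) = (\<lambda>t. r (Inr t)) \<and> perm_2_3s (\<lambda>t. r (Inl t)) \<and> perm_2_3s (\<lambda>t. r (Inr t))"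
  then obtain t where l: "\<And>s. r (Inl s) + (if s = t then 1 else 0) = 3"
    unfolding perm_2_3s_iff by blast
  have eq: "r (Inr s) = r (Inl s)" for s using * by (simp add: fun_eq_iff)
  have "r c + (if c = Inl t \<or> c = Inr t then 1 else 0) = 3" for c
    by (cases c) (use l in \<open>simp_all add: eq\<close>)
  then show "\<exists>t. balanced r t"
    unfolding balanced_def by blast
qed

lemma labelling_monomial_in_f_monomials_iff:
  fixes l :: "nat \<Rightarrow> 'n::finite + 'n"
  assumes "l \<in> {1..2 * (3 * CARD('n) - 1)} \<rightarrow>\<^sub>E UNIV"
  shows "labelling_monomial l \<in> f_monomials \<longleftrightarrow> l \<in> labellings"
proof -
  have lin: "multilinear_in {1..2 * (3 * CARD('n) - 1)} (labelling_monomial l)"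
    by (simp add: multilinear_in_def lookup_labelling_monomial)
  have types: "type_x (labelling_monomial l) =
      (\<lambda>t. card {i \<in> {1..2 * (3 * CARD('n) - 1)}. l i = Inl t})"
    "type_y (labelling_monomial l) = (\<lambda>t. card {i \<in> {1..2 * (3 * CARD('n) - 1)}. l i = Inr t})"
    by (simp_all add: fun_eq_iff type_labelling_monomial)
  show ?thesis
    unfolding f_monomials_def labellings_def mem_Collect_eq balanced_iff_types types
    using assms keys_labelling_monomial[of l] lin by blast
qed

lemma multilinear_monomial_is_labelling:
  fixes mon :: "'n::finite coord monomial"
  assumes keys: "Poly_Mapping.keys mon \<subseteq> UNIV \<times> {1..2 * (3 * CARD('n) - 1)}"
    and lin: "multilinear_in {1..2 * (3 * CARD('n) - 1)} mon"
  shows "\<exists>l \<in> {1..2 * (3 * CARD('n) - 1)} \<rightarrow>\<^sub>E UNIV. mon = labelling_monomial l"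
proof -
  let ?I = "{1..2 * (3 * CARD('n) - 1)}"
  have "\<forall>i\<in>?I. \<exists>c. \<forall>d. Poly_Mapping.lookup mon (d, i) = (if c = d then 1 else 0)"
  proof
    fix i assume "i \<in> ?I"
    then have "(\<Sum>c\<in>UNIV. Poly_Mapping.lookup mon (c, i)) = 1"
      using lin unfolding multilinear_in_def by blast
    then obtain c where "Poly_Mapping.lookup mon (c, i) = 1"
        "\<forall>b\<in>UNIV. c \<noteq> b \<longrightarrow> Poly_Mapping.lookup mon (b, i) = 0"
      unfolding sum_eq_1_iff[OF finite] by blast
    then show "\<exists>c. \<forall>d. Poly_Mapping.lookup mon (d, i) = (if c = d then 1 else 0)"
      by (intro exI[of _ c]) auto
  qed
  from bchoice[OF this] obtain l where
    "\<forall>i\<in>?I. \<forall>d. Poly_Mapping.lookup mon (d, i) = (if l i = d then 1 else 0)" ..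
  then have l: "Poly_Mapping.lookup mon (d, i) = (if l i = d then 1 else 0)" if "i \<in> ?I" for i d
    using that by blast
  have "mon = labelling_monomial (restrict l ?I)"
  proof (rule poly_mapping_eqI)
    fix x :: "('n + 'n) \<times> nat"
    obtain d i where x: "x = (d, i)" by (cases x)
    show "Poly_Mapping.lookup mon x = Poly_Mapping.lookup (labelling_monomial (restrict l ?I)) x"
    proof (cases "i \<in> ?I")
      case True
      then show ?thesis by (simp add: x l lookup_labelling_monomial del: atLeastAtMost_iff)
    next
      case False
      then have "x \<notin> Poly_Mapping.keys mon" using keys x by auto
      then show ?thesis
        using False by (simp add: x lookup_labelling_monomial in_keys_iff del: atLeastAtMost_iff)
    qed
  qed
  moreover have "restrict l ?I \<in> ?I \<rightarrow>\<^sub>E UNIV" by simp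
  ultimately show ?thesis ..
qed

lemma inj_on_labelling_monomial:
  "inj_on labelling_monomial ({1..2 * (3 * CARD('n) - 1)} \<rightarrow>\<^sub>E (UNIV :: ('n::finite + 'n) set))"
proof (rule inj_onI)
  let ?I = "{1..2 * (3 * CARD('n) - 1)}"
  fix l l' :: "nat \<Rightarrow> 'n + 'n"
  assume l: "l \<in> ?I \<rightarrow>\<^sub>E UNIV" "l' \<in> ?I \<rightarrow>\<^sub>E UNIV"
    and eq: "labelling_monomial l = labelling_monomial l'"
  show "l = l'"
  proof (rule PiE_ext[OF l])
    fix i assume i: "i \<in> ?I"
    show "l i = l' i"
    proof (rule ccontr)
      assume "l i \<noteq> l' i"
      then have "Poly_Mapping.lookup (labelling_monomial l') (l i, i) = 0"
        unfolding lookup_labelling_monomial by (intro if_not_P notI) (erule conjE, simp)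
      moreover have "Poly_Mapping.lookup (labelling_monomial l) (l i, i) = 1"
        unfolding lookup_labelling_monomial using i by (intro if_P) blast
      ultimately show False
        unfolding eq by simp
    qed
  qed
qed

text \<open>The labellings are in bijection with the monomials of the polynomial, which are square-free.\<close>

lemma f_poly_eq_multilinear_form: "(f_poly :: ('n::finite coord, 'k::comm_ring_1) mpoly) = multilinear_form ivec"
proof -
  let ?I = "{1..2 * (3 * CARD('n) - 1)}"
  have inj: "inj_on labelling_monomial (labellings :: (nat \<Rightarrow> 'n + 'n) set)"
    by (rule inj_on_subset[OF inj_on_labelling_monomial]) (auto simp: labellings_def)
  have "labelling_monomial ` labellings = (f_monomials :: 'n coord monomial set)"
  proof (intro equalityI subsetI)
    fix mon :: "'n coord monomial" assume "mon \<in> labelling_monomial ` labellings"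
    then obtain l where l: "l \<in> labellings" "mon = labelling_monomial l" by blast
    moreover from l have "l \<in> ?I \<rightarrow>\<^sub>E UNIV" by (simp add: labellings_def)
    ultimately show "mon \<in> f_monomials"
      by (simp only: labelling_monomial_in_f_monomials_iff)
  next
    fix mon :: "'n coord monomial" assume mon: "mon \<in> f_monomials"
    then obtain l where "l \<in> ?I \<rightarrow>\<^sub>E UNIV" "mon = labelling_monomial l"
      using multilinear_monomial_is_labelling[of mon] unfolding f_monomials_def by blast
    with mon show "mon \<in> labelling_monomial ` labellings"
      by (simp only: labelling_monomial_in_f_monomials_iff) blast
  qed
  then have "(f_poly :: ('n coord, 'k) mpoly) = (\<Sum>mon\<in>labelling_monomial ` labellings.
      Poly_Mapping.single mon (1::'k))"
    by (simp add: f_poly_def)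
  also have "\<dots> = (\<Sum>l\<in>labellings. Poly_Mapping.single (labelling_monomial l) 1)"
    by (simp add: sum.reindex[OF inj])
  also have "\<dots> = multilinear_form ivec"
    by (simp add: multilinear_form_def ivec_def labelling_monomial_def prod_Var_image)
  finally show ?thesis .
qed

lemma mpoly_subst_multilinear_form: "mpoly_subst s (multilinear_form u) = multilinear_form (\<lambda>i c. mpoly_subst s (u i c))"
  by (simp add: multilinear_form_def mpoly_subst_sum mpoly_subst_prod)

section \<open>The form as a top coefficient\<close>

text \<open>The vector \<open>u i\<close> is turned into the linear form with coefficients \<open>u i c\<close> in auxiliary variables, one for
  each coordinate, and the quadratic form in the auxiliary variables is a further factor.\<close>

definition form_times_vectors :: "(nat \<Rightarrow> 'n::finite + 'n \<Rightarrow> 'r::comm_ring_1) \<Rightarrow> ('n + 'n, 'r) mpoly" where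
  "form_times_vectors u = qform Var *
     (\<Prod>i\<in>{1..2 * (3 * CARD('n) - 1)}. \<Sum>c\<in>UNIV. Const (u i c) * Var c)"

definition plane_monomial :: "'n \<Rightarrow> ('n + 'n) monomial" where
  "plane_monomial t = Poly_Mapping.single (Inl t) 1 + Poly_Mapping.single (Inr t) 1"

lemma lookup_plane_monomial:
  "Poly_Mapping.lookup (plane_monomial t) c = (if c = Inl t \<or> c = Inr t then 1 else 0)"
  by (auto simp: plane_monomial_def lookup_add lookup_single when_def)

lemma form_times_vectors_expand:
  fixes u :: "nat \<Rightarrow> 'n::finite + 'n \<Rightarrow> 'r::comm_ring_1"
  defines "I \<equiv> {1..2 * (3 * CARD('n) - 1)}"
  shows "form_times_vectors u = (\<Sum>t\<in>UNIV. \<Sum>l \<in> I \<rightarrow>\<^sub>E UNIV.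
    Poly_Mapping.single (plane_monomial t + (\<Sum>i\<in>I. Poly_Mapping.single (l i) 1)) (\<Prod>i\<in>I. u i (l i)))"
proof -
  have "finite I" by (simp add: I_def)
  have q: "qform Var = (\<Sum>t\<in>UNIV. Poly_Mapping.single (plane_monomial (t::'n)) (1::'r))"
    by (simp add: qform_def plane_monomial_def Var_def mult_single)
  have p: "(\<Prod>i\<in>I. \<Sum>c\<in>UNIV. Const (u i c) * Var c) =
      (\<Sum>l \<in> I \<rightarrow>\<^sub>E UNIV. Poly_Mapping.single (\<Sum>i\<in>I. Poly_Mapping.single (l i) 1) (\<Prod>i\<in>I. u i (l i)))"
    using \<open>finite I\<close>
    by (subst prod_sum_PiE)
      (simp_all add: prod.distrib prod_Var_image mult_single Const_def flip: Const_prod[unfolded Const_def])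
  show ?thesis
    unfolding form_times_vectors_def I_def[symmetric] q p by (simp add: sum_product mult_single)
qed

text \<open>A term of the product of the linear forms contributes to the coefficient of the product of all cubes
  exactly if the quadratic form supplies the missing factor \<open>x\<^sub>t y\<^sub>t\<close>, and \<open>t\<close> is determined by the
  term. So each term is counted once.\<close>

lemma multilinear_form_eq_top_coefficient:
  fixes u :: "nat \<Rightarrow> 'n::finite + 'n \<Rightarrow> 'r::comm_ring_1"
  shows "multilinear_form u = Poly_Mapping.lookup (form_times_vectors u) top_monomial"
proof -
  define I where "I = {1..2 * (3 * CARD('n) - 1)}"
  let ?e = "\<lambda>l :: nat \<Rightarrow> 'n + 'n. \<Sum>i\<in>I. Poly_Mapping.single (l i) (1::nat)"
  have iff: "plane_monomial t + ?e l = top_monomial \<longleftrightarrow> balanced (\<lambda>c. card {i \<in> I. l i = c}) t" for l t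
  proof -
    have "finite I" by (simp add: I_def)
    then have "Poly_Mapping.lookup (plane_monomial t + ?e l) c =
        card {i \<in> I. l i = c} + (if c = Inl t \<or> c = Inr t then 1 else 0)" for c
      by (simp only: lookup_add lookup_sum_singles lookup_plane_monomial add.commute)
    then show ?thesis
      unfolding balanced_def poly_mapping_eq_iff fun_eq_iff by simp
  qed
  have inner: "(\<Sum>t\<in>UNIV. (\<Prod>i\<in>I. u i (l i)) when plane_monomial t + ?e l = top_monomial) =
      ((\<Prod>i\<in>I. u i (l i)) when (\<exists>t. balanced (\<lambda>c. card {i \<in> I. l i = c}) t))" for l
  proof (cases "\<exists>t. balanced (\<lambda>c. card {i \<in> I. l i = c}) t")
    case True
    then obtain t0 where t0: "balanced (\<lambda>c. card {i \<in> I. l i = c}) t0" by blast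
    have "t = t0" if "balanced (\<lambda>c. card {i \<in> I. l i = c}) t" for t
    proof (rule ccontr)
      assume "t \<noteq> t0"
      then show False
        using t0[unfolded balanced_def, rule_format, of "Inl t"]
          that[unfolded balanced_def, rule_format, of "Inl t"] by simp
    qed
    then have "balanced (\<lambda>c. card {i \<in> I. l i = c}) t \<longleftrightarrow> t = t0" for t
      using t0 by blast
    then show ?thesis by (simp only: iff when_def) simp
  next
    case False
    then show ?thesis by (simp only: iff when_def) simp
  qed
  have "Poly_Mapping.lookup (form_times_vectors u) top_monomial =
      (\<Sum>l \<in> I \<rightarrow>\<^sub>E UNIV. \<Sum>t\<in>UNIV. (\<Prod>i\<in>I. u i (l i)) when plane_monomial t + ?e l = top_monomial)"
    unfolding form_times_vectors_expand I_def[symmetric]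
    by (simp only: lookup_sum lookup_single) (rule sum.swap)
  also have "\<dots> = (\<Sum>l \<in> I \<rightarrow>\<^sub>E UNIV.
      (\<Prod>i\<in>I. u i (l i)) when (\<exists>t. balanced (\<lambda>c. card {i \<in> I. l i = c}) t))"
    by (simp only: inner)
  also have "\<dots> = (\<Sum>l\<in>labellings. \<Prod>i\<in>I. u i (l i))"
    unfolding when_def labellings_def I_def[symmetric]
    by (rule sum.inter_filter[symmetric]) (simp add: I_def finite_PiE)
  finally show ?thesis
    by (simp add: multilinear_form_def I_def)
qed

lemma form_times_vectors_homogeneous:
  fixes u :: "nat \<Rightarrow> 'n::finite + 'n \<Rightarrow> 'r::comm_ring_1"
  assumes "mon \<in> Poly_Mapping.keys (form_times_vectors u)"
  shows "(\<Sum>c\<in>UNIV. Poly_Mapping.lookup mon c) = 3 * CARD('n + 'n)"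
proof -
  define I where "I = {1..2 * (3 * CARD('n) - 1)}"
  let ?e = "\<lambda>l :: nat \<Rightarrow> 'n + 'n. \<Sum>i\<in>I. Poly_Mapping.single (l i) (1::nat)"
  have "\<exists>t. \<exists>l. mon = plane_monomial t + ?e l"
  proof (rule ccontr)
    assume "\<not> ?thesis"
    then have "plane_monomial t + ?e l \<noteq> mon" for t l by metis
    then have "Poly_Mapping.lookup (form_times_vectors u) mon = 0"
      unfolding form_times_vectors_expand I_def[symmetric]
      by (simp add: lookup_sum lookup_single)
    with assms show False by (simp add: in_keys_iff)
  qed
  then obtain t l where mon: "mon = plane_monomial t + ?e l" by blast
  have "(\<Sum>c\<in>UNIV. Poly_Mapping.lookup (plane_monomial t) c) = 2"
    by (simp add: plane_monomial_def lookup_add lookup_single when_def sum.distrib)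
  moreover have "(\<Sum>c\<in>UNIV. Poly_Mapping.lookup (?e l) c) = card I"
    unfolding lookup_sum by (subst sum.swap) (simp add: lookup_single when_def)
  ultimately have "(\<Sum>c\<in>UNIV. Poly_Mapping.lookup mon c) = 2 + card I"
    by (simp only: mon lookup_add sum.distrib)
  moreover have "card I = 2 * (3 * CARD('n) - 1)"
    unfolding I_def by simp
  moreover have "0 < CARD('n)" by simp
  moreover have "CARD('n + 'n) = 2 * CARD('n)" by (simp add: card_UNIV_sum)
  ultimately show ?thesis by linarith
qed

text \<open>Applying \<open>A\<close> to the vectors is the same as applying the linear substitution to their linear forms.
  The quadratic factor is fixed by the substitution, so the whole product is transformed, and its top
  coefficient changes by \<open>det\<^sup>3 = 1\<close>.\<close>

theorem multilinear_form_linear_invariant: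
  fixes A :: "'r::comm_ring_1 ^ ('n::finite + 'n) ^ ('n + 'n)"
  assumes two: "(2::'r) = 0" and det: "det A = 1"
    and q: "qform (linear_subst A) = qform Var"
  shows "multilinear_form (\<lambda>i c. \<Sum>d\<in>UNIV. A $ c $ d * u i d) = multilinear_form u"
proof -
  have "mpoly_subst (linear_subst A) (\<Sum>d\<in>UNIV. Const (u i d) * Var d) =
      (\<Sum>c\<in>UNIV. Const (\<Sum>d\<in>UNIV. A $ c $ d * u i d) * Var c)" for i
  proof -
    have "mpoly_subst (linear_subst A) (\<Sum>d\<in>UNIV. Const (u i d) * Var d) =
        (\<Sum>d\<in>UNIV. \<Sum>c\<in>UNIV. Const (A $ c $ d * u i d) * Var c)"
      by (simp add: mpoly_subst_sum mpoly_subst_mult linear_subst_def sum_distrib_left Const_mult mult_ac)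
    also have "\<dots> = (\<Sum>c\<in>UNIV. \<Sum>d\<in>UNIV. Const (A $ c $ d * u i d) * Var c)"
      by (rule sum.swap)
    finally show ?thesis
      by (simp add: Const_sum sum_distrib_right)
  qed
  moreover have "mpoly_subst (linear_subst A) (qform Var) = qform (linear_subst A)"
    by (simp add: qform_def mpoly_subst_sum mpoly_subst_mult)
  ultimately have "mpoly_subst (linear_subst A) (form_times_vectors u) =
      form_times_vectors (\<lambda>i c. \<Sum>d\<in>UNIV. A $ c $ d * u i d)"
    unfolding form_times_vectors_def by (simp only: mpoly_subst_mult mpoly_subst_prod q)
  then show ?thesis
    unfolding multilinear_form_eq_top_coefficient
    using homogeneous_linear_subst[OF two det, of "form_times_vectors u" top_monomial]
    by (simp add: form_times_vectors_homogeneous)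
qed

section \<open>Orthogonal matrices in characteristic two\<close>

lemma polar_commute: "polar v w = polar w v"
  by (simp add: polar_eq add.commute mult.commute)

lemma polar_sum_right: "polar v (\<lambda>d. \<Sum>x\<in>D. b x d) = (\<Sum>x\<in>D. polar v (b x))"
proof -
  have "polar v (\<lambda>d. \<Sum>x\<in>D. b x d) =
      (\<Sum>t\<in>UNIV. \<Sum>x\<in>D. v (Inl t) * b x (Inr t) + v (Inr t) * b x (Inl t))"
    by (simp add: polar_eq sum_distrib_left sum.distrib)
  also have "\<dots> = (\<Sum>x\<in>D. polar v (b x))"
    unfolding polar_eq by (rule sum.swap)
  finally show ?thesis .
qed

lemma qform_Const_scale: "qform (\<lambda>d. Const (v d) * z) = Const (qform v) * z\<^sup>2"
  by (simp add: qform_def Const_sum Const_mult sum_distrib_left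
      power2_eq_square mult_ac)

lemma polar_Const_scale:
  "polar (\<lambda>d. Const (v d) * y) (\<lambda>d. Const (w d) * z) = Const (polar v w) * (y * z)"
  by (simp add: polar_eq Const_sum Const_mult Const_add sum_distrib_left
      distrib_left mult_ac)

text \<open>The values of a quadratic form on \<open>e\<^sub>c\<close> and \<open>e\<^sub>b + e\<^sub>c\<close> determine its coefficients. Hence a matrix
  that preserves the form on vectors over a ring preserves it on vectors over any polynomial extension.
  This turns the defining property of the orthogonal group into an identity of polynomials.\<close>

lemma qform_preserving_Const:
  fixes M :: "'n::finite + 'n \<Rightarrow> 'n + 'n \<Rightarrow> 'r::comm_ring_1" and z :: "'n + 'n \<Rightarrow> ('v, 'r) mpoly"
  assumes M: "\<And>v. qform (\<lambda>d. \<Sum>c\<in>UNIV. M d c * v c) = qform v"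
  shows "qform (\<lambda>d. \<Sum>c\<in>UNIV. Const (M d c) * z c) = qform z"
proof -
  let ?e = "\<lambda>c d. if d = c then 1 else (0::'r)"
  have e: "(\<Sum>x\<in>UNIV. M d x * ?e c x) = M d c" for c d
    by (simp add: if_distrib cong: if_cong)
  have Q: "qform (\<lambda>d. M d c) = qform (?e c)" for c
    using M[of "?e c"] by (simp only: e)
  have QQ: "qform (\<lambda>d. M d b + M d c) = qform (\<lambda>d. ?e b d + ?e c d)" for b c
    using M[of "\<lambda>x. ?e b x + ?e c x"] by (simp only: distrib_left sum.distrib e)
  have B: "polar (\<lambda>d. M d b) (\<lambda>d. M d c) = polar (?e b) (?e c)" for b c
    by (simp only: polar_def Q QQ)
  have "qform (\<lambda>d. \<Sum>c\<in>D. Const (M d c) * z c) = qform (\<lambda>d. \<Sum>c\<in>D. Const (?e c d) * z c)"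
    if "finite D" for D
    using that
  proof (induction D rule: finite_induct)
    case empty
    then show ?case by simp
  next
    case (insert x D)
    have add: "qform (\<lambda>d. a d + b d) = qform a + qform b + polar a b" for a b :: "'n + 'n \<Rightarrow> ('v, 'r) mpoly"
      by (simp add: polar_def)
    show ?case
      by (simp only: sum.insert[OF insert.hyps] add insert.IH polar_sum_right qform_Const_scale
          polar_Const_scale B Q)
  qed
  from this[of UNIV] have "qform (\<lambda>d. \<Sum>c\<in>UNIV. Const (M d c) * z c) =
      qform (\<lambda>d. \<Sum>c\<in>UNIV. Const (?e c d) * z c)"
    by simp
  also have "(\<lambda>d. \<Sum>c\<in>UNIV. Const (?e c d) * z c) = z"
  proof
    fix d
    have "(\<Sum>c\<in>UNIV. Const (?e c d) * z c) = (\<Sum>c\<in>UNIV. if d = c then z c else 0)"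
      by (rule sum.cong) auto
    then show "(\<Sum>c\<in>UNIV. Const (?e c d) * z c) = z d"
      by simp
  qed
  finally show ?thesis .
qed

text \<open>The permutation \<open>x\<^sub>t \<leftrightarrow> y\<^sub>t\<close> of the coordinates, whose matrix is the Gram matrix of the polar form.\<close>

definition swap_sum :: "'a + 'a \<Rightarrow> 'a + 'a" where
  "swap_sum = case_sum Inr Inl"

lemma swap_sum_simps [simp]:
  "swap_sum (Inl t) = Inr t" "swap_sum (Inr t) = Inl t" "swap_sum (swap_sum c) = c"
  by (simp_all add: swap_sum_def split: sum.split)

lemma bij_swap_sum: "bij swap_sum"
  by (rule involuntory_imp_bij) simp

lemma qform_swap: "qform (\<lambda>c. v (swap_sum c)) = qform v"
  by (simp add: qform_def mult.commute)

lemma polar_axis: "polar v (($) (axis c 1)) = v (swap_sum c)"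
proof (cases c)
  case (Inl s)
  have "v (Inl t) * axis c 1 $ Inr t + v (Inr t) * axis c 1 $ Inl t = (if s = t then v (Inr t) else 0)" for t
    by (simp add: Inl axis_def)
  then show ?thesis by (simp add: polar_eq Inl)
next
  case (Inr s)
  have "v (Inl t) * axis c 1 $ Inr t + v (Inr t) * axis c 1 $ Inl t = (if s = t then v (Inl t) else 0)" for t
    by (simp add: Inr axis_def)
  then show ?thesis by (simp add: polar_eq Inr)
qed

lemma matrix_vector_mult_axis: "(A *v axis c 1) $ d = A $ d $ (c :: 'n::finite)"
  by (simp add: matrix_vector_mult_def axis_def if_distrib cong: if_cong)

context
  fixes g :: "'k::field ^ ('n::finite + 'n) \<Rightarrow> 'k ^ ('n + 'n)"
  assumes g: "g \<in> orth_group"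
begin

lemma orth_linear: "Vector_Spaces.linear (*s) (*s) g"
  and orth_bij: "bij g"
  and orth_qform: "qform (($) (g v)) = qform (($) v)"
  using g by (simp_all add: orth_group_def)

lemma orth_polar: "polar (($) (g v)) (($) (g w)) = polar (($) v) (($) w)"
proof -
  have "(\<lambda>c. g v $ c + g w $ c) = ($) (g (v + w))"
    using orth_linear by (simp add: Vector_Spaces.linear_iff fun_eq_iff)
  moreover have "(\<lambda>c. v $ c + w $ c) = ($) (v + w)"
    by (simp add: fun_eq_iff)
  ultimately show ?thesis
    by (simp only: polar_def orth_qform)
qed

lemma orth_inv_linear: "Vector_Spaces.linear (*s) (*s) (inv g)"
proof -
  have gi: "g (inv g x) = x" for x
    by (rule surj_f_inv_f) (rule bij_is_surj[OF orth_bij])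
  have inj: "x = y" if "g x = g y" for x y
    by (rule injD[OF bij_is_inj[OF orth_bij] that])
  have add: "g (x + y) = g x + g y" and scale: "g (c *s x) = c *s g x" for c x y
    using orth_linear unfolding Vector_Spaces.linear_iff by blast+
  have "inv g (x + y) = inv g x + inv g y" for x y
    by (rule inj) (simp only: gi add)
  moreover have "inv g (c *s x) = c *s inv g x" for c x
    by (rule inj) (simp only: gi scale)
  ultimately show ?thesis
    using orth_linear unfolding Vector_Spaces.linear_iff by blast
qed

text \<open>For an isometry the inverse is the adjoint with respect to the polar form: compare
  \<open>\<beta>(g e, e')\<close> with \<open>\<beta>(e, g\<inverse> e')\<close> on basis vectors.\<close>

lemma orth_matrix_inv_entry:
  "matrix (inv g) $ c $ d = matrix g $ swap_sum d $ swap_sum c"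
proof -
  let ?a = "axis (swap_sum c) 1 :: 'k ^ ('n + 'n)" and ?b = "axis d 1 :: 'k ^ ('n + 'n)"
  have "g (inv g ?b) = ?b"
    by (rule surj_f_inv_f) (rule bij_is_surj[OF orth_bij])
  then have "polar (($) (g ?a)) (($) ?b) = polar (($) ?a) (($) (inv g ?b))"
    using orth_polar[of ?a "inv g ?b"] by (simp only:)
  also have "\<dots> = polar (($) (inv g ?b)) (($) ?a)"
    by (rule polar_commute)
  also have "\<dots> = inv g ?b $ c"
    by (simp only: polar_axis swap_sum_simps)
  finally have *: "g ?a $ swap_sum d = inv g ?b $ c"
    by (simp only: polar_axis)
  have "matrix (inv g) $ c $ d = (matrix (inv g) *v ?b) $ c"
    by (rule matrix_vector_mult_axis[symmetric])
  also have "\<dots> = inv g ?b $ c"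
    by (simp only: matrix_works[OF orth_inv_linear])
  also have "\<dots> = g ?a $ swap_sum d"
    by (rule *[symmetric])
  also have "\<dots> = (matrix g *v ?a) $ swap_sum d"
    by (simp only: matrix_works[OF orth_linear])
  also have "\<dots> = matrix g $ swap_sum d $ swap_sum c"
    by (rule matrix_vector_mult_axis)
  finally show ?thesis .
qed

text \<open>The linear forms in the auxiliary variables are moved by the transpose of the inverse matrix. By the
  adjoint formula that transpose is conjugate to the matrix of \<open>g\<close> under the coordinate swap, which
  preserves the quadratic form.\<close>

lemma orth_transpose_inv_qform:
  "qform (\<lambda>d. \<Sum>c\<in>UNIV. matrix (inv g) $ c $ d * v c) = qform v"
proof -
  define w where "w = (\<chi> c. v (swap_sum c))"
  have "(\<Sum>c\<in>UNIV. matrix (inv g) $ c $ d * v c) = g w $ swap_sum d" for d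
  proof -
    have "(\<Sum>c\<in>UNIV. matrix (inv g) $ c $ d * v c) =
        (\<Sum>c\<in>UNIV. matrix g $ swap_sum d $ swap_sum c * w $ swap_sum c)"
      by (simp add: orth_matrix_inv_entry w_def)
    also have "\<dots> = (\<Sum>c\<in>UNIV. matrix g $ swap_sum d $ c * w $ c)"
      by (rule sum.reindex_bij_betw[OF bij_swap_sum, of "\<lambda>c. matrix g $ swap_sum d $ c * w $ c"])
    also have "\<dots> = (matrix g *v w) $ swap_sum d"
      by (simp add: matrix_vector_mult_def)
    finally show ?thesis by (simp add: matrix_works[OF orth_linear])
  qed
  then have "qform (\<lambda>d. \<Sum>c\<in>UNIV. matrix (inv g) $ c $ d * v c) = qform (\<lambda>d. g w $ swap_sum d)"
    by (simp only:)
  also have "\<dots> = qform (($) (g w))"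
    by (rule qform_swap)
  also have "\<dots> = qform (($) w)"
    by (rule orth_qform)
  also have "\<dots> = qform v"
  proof -
    have "($) w = (\<lambda>c. v (swap_sum c))"
      by (simp add: w_def fun_eq_iff)
    then show ?thesis by (simp only: qform_swap)
  qed
  finally show ?thesis .
qed

text \<open>By the adjoint formula \<open>g\<close> and its inverse have the same determinant, so its square is 1; in
  characteristic 2 the only square root of 1 is 1.\<close>

lemma orth_det_inv:
  assumes "(2::'k) = 0"
  shows "det (matrix (inv g)) = 1"
proof -
  have p: "(swap_sum :: 'n + 'n \<Rightarrow> _) permutes UNIV"
    by (rule bij_imp_permutes) (simp_all add: bij_swap_sum)
  define C where "C = (\<chi> i j. matrix g $ i $ swap_sum j)"
  have "transpose (matrix (inv g)) = (\<chi> i. C $ swap_sum i)"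
    by (simp only: C_def vec_eq_iff transpose_def orth_matrix_inv_entry vec_lambda_beta) simp
  then have "det (transpose (matrix (inv g))) = det (\<chi> i. C $ swap_sum i)"
    by (simp only:)
  also have "\<dots> = of_int (sign (swap_sum :: 'n + 'n \<Rightarrow> _)) * det C"
    by (rule det_permute_rows[OF p])
  also have "det C = of_int (sign (swap_sum :: 'n + 'n \<Rightarrow> _)) * det (matrix g)"
    unfolding C_def by (rule det_permute_columns[OF p])
  also have "of_int (sign (swap_sum :: 'n + 'n \<Rightarrow> _)) *
      (of_int (sign (swap_sum :: 'n + 'n \<Rightarrow> _)) * det (matrix g)) = det (matrix g)"
  proof -
    have "of_int (sign (swap_sum :: 'n + 'n \<Rightarrow> _)) * of_int (sign (swap_sum :: 'n + 'n \<Rightarrow> _)) = (1::'k)"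
      by (simp only: of_int_mult[symmetric] sign_idempotent of_int_1)
    then show ?thesis by (simp only: mult.assoc[symmetric] mult_1_left)
  qed
  finally have eq: "det (matrix (inv g)) = det (matrix g)" by simp
  have "inv g \<circ> g = id"
    by (rule inv_o_cancel) (rule bij_is_inj[OF orth_bij])
  then have "matrix (inv g) ** matrix g = mat 1"
    using matrix_compose_gen[OF orth_linear orth_inv_linear] matrix_id_mat_1 by metis
  then have "det (matrix (inv g)) * det (matrix (inv g)) = 1"
    using det_mul[of "matrix (inv g)" "matrix g"] by (simp only: eq det_I)
  then have "det (matrix (inv g)) = 1 \<or> det (matrix (inv g)) = - 1"
    by (simp only: square_eq_1_iff)
  moreover have minus_one: "- 1 = (1::'k)"
    using assms by (metis add.inverse_unique one_add_one)
  ultimately show ?thesis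
    unfolding minus_one by blast
qed

end

lemma orth_act_f_poly:
  fixes g :: "'k::field ^ ('n::finite + 'n) \<Rightarrow> 'k ^ ('n + 'n)"
  assumes g: "g \<in> orth_group" and two: "(2::'k) = 0"
  shows "orth_act g f_poly = f_poly"
proof -
  define A :: "('n coord, 'k) mpoly ^ ('n + 'n) ^ ('n + 'n)" where
    "A = (\<chi> c d. Const (matrix (inv g) $ c $ d))"
  have two': "(2 :: ('n coord, 'k) mpoly) = 0"
    by (rule mpoly_two_eq_0[OF two])
  have det: "det A = 1"
  proof -
    have "det A = Const (det (matrix (inv g)))"
      by (simp add: A_def det_char2[OF two'] det_char2[OF two] Const_sum Const_prod)
    then show ?thesis by (simp add: orth_det_inv[OF g two])
  qed
  have "qform (linear_subst A) = qform Var"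
  proof -
    have "qform (\<lambda>d. \<Sum>c\<in>UNIV. Const (matrix (inv g) $ c $ d) * z c) = qform z"
      for z :: "'n + 'n \<Rightarrow> ('n coord, 'k) mpoly"
      by (rule qform_preserving_Const) (rule orth_transpose_inv_qform[OF g])
    then have "qform (\<lambda>d. \<Sum>c\<in>UNIV. A $ c $ d * z c) = qform z"
      for z :: "'n + 'n \<Rightarrow> ('n coord, 'k) mpoly"
      by (simp only: A_def vec_lambda_beta)
    \<comment> \<open>Two extensions of scalars: first to the coordinates of the vectors, then to the auxiliary variables.\<close>
    from qform_preserving_Const[of "\<lambda>d c. A $ c $ d", OF this, of Var]
    show ?thesis by (simp only: linear_subst_def[abs_def])
  qed
  from multilinear_form_linear_invariant[OF two' det this, of ivec]
  have "multilinear_form (\<lambda>i c. \<Sum>d\<in>UNIV. A $ c $ d * ivec i d) = f_poly"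
    by (simp only: f_poly_eq_multilinear_form)
  moreover have "orth_act g f_poly = multilinear_form (\<lambda>i c. \<Sum>d\<in>UNIV. A $ c $ d * ivec i d)"
    by (simp add: orth_act_def f_poly_eq_multilinear_form mpoly_subst_multilinear_form A_def ivec_def[of _ _, symmetric])
      (simp add: ivec_def)
  ultimately show ?thesis by simp
qed

lemma f_poly_in_R_alg:
  assumes "m \<ge> 2 * (3 * CARD('n) - 1)"
  shows "(f_poly :: ('n::finite coord, 'k::field) mpoly) \<in> R_alg m"
  unfolding R_alg_def polys_in_def
proof (intro CollectI ballI)
  fix mon assume mon: "mon \<in> Poly_Mapping.keys (f_poly :: ('n coord, 'k) mpoly)"
  have "mon \<in> f_monomials"
  proof (rule ccontr)
    assume "mon \<notin> f_monomials"
    then have "Poly_Mapping.lookup (f_poly :: ('n coord, 'k) mpoly) mon = 0"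
      unfolding f_poly_def lookup_sum by (intro sum.neutral) (auto simp: lookup_single when_def)
    with mon show False by (simp add: in_keys_iff)
  qed
  then have "Poly_Mapping.keys mon \<subseteq> UNIV \<times> {1..2 * (3 * CARD('n) - 1)}"
    unfolding f_monomials_def by blast
  also have "\<dots> \<subseteq> UNIV \<times> {1..m}"
    using assms by (intro Sigma_mono) auto
  finally show "Poly_Mapping.keys mon \<subseteq> UNIV \<times> {1..m}" .
qed

section \<open>A specialization separating the form from the quadratic invariants\<close>

text \<open>With \<open>\<delta> = Var 0\<close> and \<open>z\<^sub>i = Var i\<close> for \<open>i = 2, 3, 4\<close>: every monomial has at least as many disjoint squares
  \<open>z\<^sub>i\<^sup>2\<close> as factors \<open>\<delta>\<close>. Products of such monomials are again of this kind. The monomials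
  \<open>z\<^sub>i\<close> and \<open>\<delta> z\<^sub>i\<^sup>2\<close> qualify, but \<open>\<delta> z\<^sub>2 z\<^sub>3 z\<^sub>4\<close> does not.\<close>

definition half_degree_subring :: "(nat, 'a::comm_ring_1) mpoly set" where
  "half_degree_subring = {p. \<forall>mon\<in>Poly_Mapping.keys p.
     Poly_Mapping.lookup mon 0 \<le> (\<Sum>i\<in>{2,3,4}. Poly_Mapping.lookup mon i div 2)}"

lemma half_degree_subring_0: "0 \<in> half_degree_subring"
  by (simp add: half_degree_subring_def)

lemma half_degree_subring_Const: "Const c \<in> half_degree_subring"
  by (simp add: half_degree_subring_def Const_def)

lemma half_degree_subring_1: "1 \<in> half_degree_subring"
  using half_degree_subring_Const[of 1] by simp

lemma half_degree_subring_add: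
  assumes "p \<in> half_degree_subring" "q \<in> half_degree_subring"
  shows "p + q \<in> half_degree_subring"
  using assms keys_add[of p q] unfolding half_degree_subring_def by blast

lemma half_degree_subring_mult:
  assumes "p \<in> half_degree_subring" "q \<in> half_degree_subring"
  shows "p * q \<in> half_degree_subring"
  unfolding half_degree_subring_def
proof safe
  fix mon assume "mon \<in> Poly_Mapping.keys (p * q)"
  then obtain a b where mon: "mon = a + b" "a \<in> Poly_Mapping.keys p" "b \<in> Poly_Mapping.keys q"
    using keys_mult[of p q] by blast
  let ?h = "\<lambda>mon :: nat monomial. \<Sum>i\<in>{2,3,4}. Poly_Mapping.lookup mon i div 2"
  have "Poly_Mapping.lookup a 0 \<le> ?h a" "Poly_Mapping.lookup b 0 \<le> ?h b"
    using assms mon unfolding half_degree_subring_def by blast+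
  then have "Poly_Mapping.lookup mon 0 \<le> ?h a + ?h b"
    by (simp only: mon lookup_add add_mono)
  also have "\<dots> \<le> ?h mon"
    unfolding sum.distrib[symmetric] mon lookup_add by (rule sum_mono) linarith
  finally show "Poly_Mapping.lookup mon 0 \<le> ?h mon" .
qed

lemma half_degree_subring_sum:
  assumes "\<And>x. x \<in> A \<Longrightarrow> f x \<in> half_degree_subring"
  shows "sum f A \<in> half_degree_subring"
  using assms by (induction A rule: infinite_finite_induct)
    (simp_all add: half_degree_subring_0 half_degree_subring_add)

lemma half_degree_subring_prod:
  assumes "\<And>x. x \<in> A \<Longrightarrow> f x \<in> half_degree_subring"
  shows "prod f A \<in> half_degree_subring"
  using assms by (induction A rule: infinite_finite_induct)
    (simp_all add: half_degree_subring_1 half_degree_subring_mult)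

lemma half_degree_subring_power:
  assumes "p \<in> half_degree_subring"
  shows "p ^ n \<in> half_degree_subring"
  by (induction n) (simp_all add: half_degree_subring_1 half_degree_subring_mult assms)

lemma half_degree_subring_Var:
  assumes "i \<in> {2,3,4}"
  shows "Var i \<in> half_degree_subring"
  using assms by (auto simp: half_degree_subring_def Var_def lookup_single)

lemma half_degree_subring_0_square:
  assumes "i \<in> {2,3,4}"
  shows "Var 0 * Var i * Var i \<in> half_degree_subring"
  using assms by (auto simp: half_degree_subring_def Var_def lookup_single mult_single lookup_add)

text \<open>With \<open>h\<close> enumerating the hyperbolic planes, consecutive blocks of six vectors get the labels
  \<open>x x x y y y\<close> of one plane. The shift by one shortens the first block, whose four vectors
  \<open>1, 2, 3, 4\<close> get the labels \<open>x, y, y, y\<close>.\<close>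

definition base_label :: "(nat \<Rightarrow> 'n) \<Rightarrow> nat \<Rightarrow> 'n + 'n" where
  "base_label h i = (if (i + 1) mod 6 < 3 then Inl (h ((i + 1) div 6)) else Inr (h ((i + 1) div 6)))"

text \<open>The vectors \<open>2, 3, 4\<close> become multiples \<open>z\<^sub>i (\<delta> e\<^sub>x + e\<^sub>y)\<close> of a single vector of the first plane, so
  their mutual values \<open>\<beta>\<close> vanish in characteristic 2 while \<open>q\<close> takes the value \<open>\<delta> z\<^sub>i\<^sup>2\<close>. The remaining
  vectors that the form involves become the basis vectors named by their labels; the first one is \<open>e\<^sub>x\<close>, which pairs with \<open>z\<^sub>i (\<delta> e\<^sub>x + e\<^sub>y)\<close>
  to \<open>z\<^sub>i\<close>.\<close>

definition test_vector :: "(nat \<Rightarrow> 'n::finite) \<Rightarrow> nat \<Rightarrow> 'n + 'n \<Rightarrow> (nat, 'k::comm_ring_1) mpoly" where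
  "test_vector h i c =
     (if i \<in> {2,3,4} then
        if c = Inl (h 0) then Var 0 * Var i else if c = Inr (h 0) then Var i else 0
      else if i \<in> {1..2 * (3 * CARD('n) - 1)} \<and> c = base_label h i then 1 else 0)"

text \<open>The only labellings that survive the specialization: one of the vectors \<open>2, 3, 4\<close> contributes its
  \<open>x\<close>-coordinate.\<close>

definition test_labelling :: "(nat \<Rightarrow> 'n::finite) \<Rightarrow> nat \<Rightarrow> nat \<Rightarrow> 'n + 'n" where
  "test_labelling h j =
     (\<lambda>i\<in>{1..2 * (3 * CARD('n) - 1)}. if i = j then Inl (h 0) else base_label h i)"

lemma test_vector_outside:
  assumes "i \<notin> {2,3,4}"
  shows "test_vector h i c \<in> {0, 1}"
  using assms by (simp add: test_vector_def)

lemma zero_one_half_degree: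
  assumes "p \<in> {0, 1}"
  shows "p \<in> half_degree_subring"
  using assms half_degree_subring_0 half_degree_subring_1 by blast

lemma test_vector_qform:
  "qform (test_vector h i) \<in> (half_degree_subring :: (nat, 'k::comm_ring_1) mpoly set)"
  unfolding qform_def
proof (rule half_degree_subring_sum)
  fix t
  show "test_vector h i (Inl t) * test_vector h i (Inr t) \<in>
      (half_degree_subring :: (nat, 'k) mpoly set)"
  proof (cases "i \<in> {2,3,4}")
    case True
    then have eq: "test_vector h i (Inl t) * test_vector h i (Inr t) =
        (if t = h 0 then Var 0 * Var i * Var i else (0 :: (nat, 'k) mpoly))"
      unfolding test_vector_def by simp
    show ?thesis
      unfolding eq using half_degree_subring_0_square[OF True] half_degree_subring_0
      by (cases "t = h 0") (simp_all only: if_True if_False simp_thms)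
  next
    case False
    show ?thesis
      by (intro half_degree_subring_mult zero_one_half_degree test_vector_outside False)
  qed
qed

context
  fixes h :: "nat \<Rightarrow> 'n::finite"
  assumes h: "bij_betw h {..<CARD('n)} UNIV"
begin

lemma h_eq_iff:
  assumes "k < CARD('n)" "l < CARD('n)"
  shows "h k = h l \<longleftrightarrow> k = l"
  using bij_betw_imp_inj_on[OF h] assms by (simp add: inj_on_eq_iff)

lemma first_four:
  assumes "1 \<le> i" "i \<le> 4"
  shows "i \<in> {1..2 * (3 * CARD('n) - 1)}"
proof -
  have "0 < CARD('n)" by simp
  then have "4 \<le> 2 * (3 * CARD('n) - 1)" by linarith
  then show ?thesis
    using assms unfolding atLeastAtMost_iff by linarith
qed

lemma base_label_eq_iff:
  assumes i: "i \<in> {1..2 * (3 * CARD('n) - 1)}" and k: "k < CARD('n)"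
  shows "base_label h i = Inl (h k) \<longleftrightarrow> 6 * k \<le> i + 1 \<and> i + 1 < 6 * k + 3"
    and "base_label h i = Inr (h k) \<longleftrightarrow> 6 * k + 3 \<le> i + 1 \<and> i + 1 < 6 * k + 6"
proof -
  define d e where "d = (i + 1) div 6" and "e = (i + 1) mod 6"
  have de: "i + 1 = 6 * d + e" "e < 6"
    by (simp_all add: d_def e_def)
  have "i \<le> 2 * (3 * CARD('n) - 1)" "0 < CARD('n)"
    using i by simp_all
  then have "6 * d < 6 * CARD('n)" using de by linarith
  then have "h d = h k \<longleftrightarrow> d = k"
    using h_eq_iff[of d k] k by simp
  then have iff: "base_label h i = Inl (h k) \<longleftrightarrow> e < 3 \<and> d = k"
      "base_label h i = Inr (h k) \<longleftrightarrow> \<not> e < 3 \<and> d = k"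
    unfolding base_label_def d_def[symmetric] e_def[symmetric] by simp_all
  have dk: "d = k" if "6 * k \<le> 6 * d + e" "6 * d + e < 6 * k + 6"
    using that de(2) by linarith
  show "base_label h i = Inl (h k) \<longleftrightarrow> 6 * k \<le> i + 1 \<and> i + 1 < 6 * k + 3"
    unfolding iff de(1) using de(2) dk by (cases "d = k") auto
  show "base_label h i = Inr (h k) \<longleftrightarrow> 6 * k + 3 \<le> i + 1 \<and> i + 1 < 6 * k + 6"
    unfolding iff de(1) using de(2) dk by (cases "d = k") auto
qed

lemma test_vector_Inr_outside:
  assumes "j \<notin> {2,3,4}"
  shows "test_vector h j (Inr (h 0)) = 0"
proof -
  have "base_label h j \<noteq> Inr (h 0)" if j: "j \<in> {1..2 * (3 * CARD('n) - 1)}"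
  proof
    assume "base_label h j = Inr (h 0)"
    then have "3 \<le> j + 1" "j + 1 < 6"
      using base_label_eq_iff(2)[OF j, of 0] by simp_all
    then have "j = 2 \<or> j = 3 \<or> j = 4" by linarith
    then show False using assms by simp
  qed
  then show ?thesis
    unfolding test_vector_def using assms by (auto simp del: atLeastAtMost_iff)
qed

text \<open>A vector outside \<open>2, 3, 4\<close> has no \<open>y\<close>-component in the first plane, so the coordinate \<open>\<delta> z\<^sub>i\<close> never enters.\<close>

lemma test_vector_polar_mixed:
  assumes i: "i \<in> {2,3,4}" and j: "j \<notin> {2,3,4}"
  shows "polar (test_vector h i) (test_vector h j) \<in>
    (half_degree_subring :: (nat, 'k::comm_ring_1) mpoly set)"
  unfolding polar_eq
proof (rule half_degree_subring_sum)
  fix t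
  show "test_vector h i (Inl t) * test_vector h j (Inr t) +
      test_vector h i (Inr t) * test_vector h j (Inl t) \<in>
      (half_degree_subring :: (nat, 'k) mpoly set)"
  proof (cases "t = h 0")
    case True
    have eq: "test_vector h i (Inr (h 0)) = (Var i :: (nat, 'k) mpoly)"
      unfolding test_vector_def using i by simp
    show ?thesis
      unfolding True test_vector_Inr_outside[OF j] eq mult_zero_right add_0_left
      by (intro half_degree_subring_mult half_degree_subring_Var i
          zero_one_half_degree test_vector_outside j)
  next
    case False
    then have "test_vector h i (Inl t) = (0 :: (nat, 'k) mpoly)"
        "test_vector h i (Inr t) = (0 :: (nat, 'k) mpoly)"
      unfolding test_vector_def using i by simp_all
    then show ?thesis by (simp add: half_degree_subring_0)
  qed
qed

lemma test_vector_polar: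
  assumes two: "(2::'k::comm_ring_1) = 0"
  shows "polar (test_vector h i) (test_vector h j) \<in> (half_degree_subring :: (nat, 'k) mpoly set)"
proof (cases "i \<in> {2,3,4}")
  case i: True
  show ?thesis
  proof (cases "j \<in> {2,3,4}")
    case j: True
    have "test_vector h i (Inl t) * test_vector h j (Inr t) +
        test_vector h i (Inr t) * test_vector h j (Inl t) = (0 :: (nat, 'k) mpoly)" for t
    proof (cases "t = h 0")
      case True
      have "test_vector h i (Inl t) * test_vector h j (Inr t) +
          test_vector h i (Inr t) * test_vector h j (Inl t) = 2 * (Var 0 * Var i * Var j :: (nat, 'k) mpoly)"
        unfolding test_vector_def True using i j by (simp add: mult_ac)
      then show ?thesis by (simp only: mpoly_two_eq_0[OF two] mult_zero_left)
    next
      case False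
      then show ?thesis
        unfolding test_vector_def using i j by simp
    qed
    then show ?thesis
      unfolding polar_eq by (simp add: half_degree_subring_0)
  next
    case j: False
    show ?thesis by (rule test_vector_polar_mixed[OF i j])
  qed
next
  case i: False
  show ?thesis
  proof (cases "j \<in> {2,3,4}")
    case j: True
    show ?thesis
      unfolding polar_commute[of "test_vector h i"] by (rule test_vector_polar_mixed[OF j i])
  next
    case j: False
    show ?thesis
      unfolding polar_eq
      by (intro half_degree_subring_sum half_degree_subring_add half_degree_subring_mult
          zero_one_half_degree test_vector_outside i j)
  qed
qed

lemma expressible_test_value:
  fixes p :: "('n coord, 'k::comm_ring_1) mpoly"
  assumes "(2::'k) = 0" and "expressible_in_QB m p"
  shows "mpoly_subst (\<lambda>(c, i). test_vector h i c) p \<in> half_degree_subring"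
proof -
  let ?s = "\<lambda>(c, i). test_vector h i c :: (nat, 'k) mpoly"
  obtain P where P: "p = mpoly_subst QB_value P"
    using assms(2) unfolding expressible_in_QB_def by blast
  have Q: "mpoly_subst ?s (Qpoly i) = qform (test_vector h i)" for i
    by (simp add: Qpoly_def qform_def ivec_def mpoly_subst_sum mpoly_subst_mult)
  have B: "mpoly_subst ?s (Bpoly i j) = polar (test_vector h i) (test_vector h j)" for i j
    by (simp add: Bpoly_def polar_eq ivec_def mpoly_subst_sum mpoly_subst_mult mpoly_subst_add)
  have "mpoly_subst ?s (QB_value x) \<in> half_degree_subring" for x
    by (cases x) (simp_all only: QB_value.simps Q B test_vector_qform test_vector_polar[OF assms(1)])
  then show ?thesis
    unfolding P mpoly_subst_def[of QB_value]
    unfolding mpoly_subst_sum mpoly_subst_mult mpoly_subst_prod mpoly_subst_power mpoly_subst_Const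
    by (intro half_degree_subring_sum half_degree_subring_mult half_degree_subring_prod
        half_degree_subring_power half_degree_subring_Const)
qed

lemma test_labelling_count_first:
  assumes j: "j \<in> {2,3,4}"
  shows "{i \<in> {1..2 * (3 * CARD('n) - 1)}. test_labelling h j i = Inl (h 0)} = {1, j}"
    and "{i \<in> {1..2 * (3 * CARD('n) - 1)}. test_labelling h j i = Inr (h 0)} = {2,3,4} - {j}"
proof -
  let ?I = "{1..2 * (3 * CARD('n) - 1)}"
  have n: "0 < CARD('n)" by simp
  have j': "j \<in> ?I" using first_four[of j] j by auto
  have label: "test_labelling h j i = (if i = j then Inl (h 0) else base_label h i)" if "i \<in> ?I" for i
    unfolding test_labelling_def restrict_def using that by (simp only: if_True)
  show "{i \<in> ?I. test_labelling h j i = Inl (h 0)} = {1, j}"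
  proof (intro equalityI subsetI)
    fix i assume "i \<in> {i \<in> ?I. test_labelling h j i = Inl (h 0)}"
    then have i: "i \<in> ?I" "i = j \<or> base_label h i = Inl (h 0)"
      using label[of i] by (auto split: if_splits)
    have "1 \<le> i" using i(1) by simp
    then show "i \<in> {1, j}"
      using i(2) unfolding base_label_eq_iff(1)[OF i(1) n] by auto
  next
    fix i assume "i \<in> {1, j}"
    moreover have "1 \<in> ?I" by (rule first_four) simp_all
    moreover have "base_label h 1 = Inl (h 0)"
      by (simp add: base_label_def)
    ultimately show "i \<in> {i \<in> ?I. test_labelling h j i = Inl (h 0)}"
      using label[of i] j' by auto
  qed
  show "{i \<in> ?I. test_labelling h j i = Inr (h 0)} = {2,3,4} - {j}"
  proof (intro equalityI subsetI)
    fix i assume "i \<in> {i \<in> ?I. test_labelling h j i = Inr (h 0)}"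
    then have i: "i \<in> ?I" "i \<noteq> j" "base_label h i = Inr (h 0)"
      using label[of i] by (auto split: if_splits)
    from i(3) have "i = 2 \<or> i = 3 \<or> i = 4"
      unfolding base_label_eq_iff(2)[OF i(1) n] by linarith
    then show "i \<in> {2,3,4} - {j}"
      using i(2) by blast
  next
    fix i assume i: "i \<in> {2,3,4} - {j}"
    then have "i \<in> ?I" using first_four[of i] by auto
    moreover have "base_label h i = Inr (h 0)"
      using i by (auto simp: base_label_def)
    ultimately show "i \<in> {i \<in> ?I. test_labelling h j i = Inr (h 0)}"
      using label[of i] i by simp
  qed
qed

lemma test_labelling_count_other:
  assumes j: "j \<in> {2,3,4}" and k: "0 < k" "k < CARD('n)"
  shows "{i \<in> {1..2 * (3 * CARD('n) - 1)}. test_labelling h j i = Inl (h k)} =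
      {6 * k - 1..6 * k + 1}"
    and "{i \<in> {1..2 * (3 * CARD('n) - 1)}. test_labelling h j i = Inr (h k)} =
      {6 * k + 2..6 * k + 4}"
proof -
  let ?I = "{1..2 * (3 * CARD('n) - 1)}"
  have jk: "j < 6 * k - 1" using j k(1) by auto
  have "h 0 \<noteq> h k" using h_eq_iff[of 0 k] k by simp
  then have label: "i \<in> ?I \<Longrightarrow> test_labelling h j i = Inl (h k) \<longleftrightarrow> i \<noteq> j \<and> base_label h i = Inl (h k)"
    "i \<in> ?I \<Longrightarrow> test_labelling h j i = Inr (h k) \<longleftrightarrow> i \<noteq> j \<and> base_label h i = Inr (h k)" for i
    unfolding test_labelling_def restrict_def by (simp_all only: if_True) simp_all
  have I: "i \<in> ?I" if "6 * k - 1 \<le> i" "i \<le> 6 * k + 4" for i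
    using that k unfolding atLeastAtMost_iff by linarith
  show "{i \<in> ?I. test_labelling h j i = Inl (h k)} = {6 * k - 1..6 * k + 1}"
  proof (rule set_eqI)
    fix i
    show "i \<in> {i \<in> ?I. test_labelling h j i = Inl (h k)} \<longleftrightarrow> i \<in> {6 * k - 1..6 * k + 1}"
    proof (cases "i \<in> ?I")
      case True
      show ?thesis
        unfolding mem_Collect_eq label[OF True] base_label_eq_iff[OF True k(2)] atLeastAtMost_iff[of i "6 * k - 1"]
        using True jk by (intro iffI conjI; (elim conjE)?; (assumption | linarith))
    next
      case False
      have "i \<notin> {6 * k - 1..6 * k + 1}"
      proof
        assume "i \<in> {6 * k - 1..6 * k + 1}"
        then have "6 * k - 1 \<le> i" "i \<le> 6 * k + 4"
          unfolding atLeastAtMost_iff by linarith+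
        then show False using I False by blast
      qed
      then show ?thesis using False by blast
    qed
  qed
  show "{i \<in> ?I. test_labelling h j i = Inr (h k)} = {6 * k + 2..6 * k + 4}"
  proof (rule set_eqI)
    fix i
    show "i \<in> {i \<in> ?I. test_labelling h j i = Inr (h k)} \<longleftrightarrow> i \<in> {6 * k + 2..6 * k + 4}"
    proof (cases "i \<in> ?I")
      case True
      show ?thesis
        unfolding mem_Collect_eq label[OF True] base_label_eq_iff[OF True k(2)] atLeastAtMost_iff[of i "6 * k + 2"]
        using True jk by (intro iffI conjI; (elim conjE)?; (assumption | linarith))
    next
      case False
      have "i \<notin> {6 * k + 2..6 * k + 4}"
      proof
        assume "i \<in> {6 * k + 2..6 * k + 4}"
        then have "6 * k - 1 \<le> i" "i \<le> 6 * k + 4"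
          unfolding atLeastAtMost_iff by linarith+
        then show False using I False by blast
      qed
      then show ?thesis using False by blast
    qed
  qed
qed

lemma test_labelling_in_labellings:
  assumes j: "j \<in> {2,3,4}"
  shows "test_labelling h j \<in> labellings"
proof -
  let ?I = "{1..2 * (3 * CARD('n) - 1)}"
  have "test_labelling h j \<in> ?I \<rightarrow>\<^sub>E UNIV"
    by (simp add: test_labelling_def)
  moreover have "balanced (\<lambda>c. card {i \<in> ?I. test_labelling h j i = c}) (h 0)"
    unfolding balanced_def
  proof
    fix c
    let ?n = "card {i \<in> ?I. test_labelling h j i = c}"
    have "\<exists>k<CARD('n). t = h k" for t
      using bij_betw_imp_surj_on[OF h] by blast
    then obtain k where k: "k < CARD('n)" and c: "c = Inl (h k) \<or> c = Inr (h k)"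
      by (cases c) blast+
    show "?n + (if c = Inl (h 0) \<or> c = Inr (h 0) then 1 else 0) = 3"
    proof (cases "k = 0")
      case True
      have "card {1, j} = 2" "card ({2,3,4} - {j}) = 2"
        using j by auto
      then have "?n = 2"
        using c test_labelling_count_first[OF j] unfolding True by (elim disjE) (simp_all only:)
      then show ?thesis using c True by auto
    next
      case False
      then have "0 < k" by simp
      have "card {6 * k - 1..6 * k + 1} = 3" "card {6 * k + 2..6 * k + 4} = 3"
        using \<open>0 < k\<close> by simp_all
      then have "?n = 3"
        using c test_labelling_count_other[OF j \<open>0 < k\<close> k] by (elim disjE) (simp_all only:)
      moreover have "h k \<noteq> h 0"
        using h_eq_iff[of k 0] k \<open>0 < k\<close> by simp
      ultimately show ?thesis using c by auto
    qed
  qed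
  ultimately show ?thesis
    unfolding labellings_def by blast
qed

text \<open>Let \<open>a\<close> of the vectors \<open>2, 3, 4\<close> be labelled by \<open>x\<close>. The label \<open>x\<close> of the first plane then occurs \<open>1 + a\<close>
  times and \<open>y\<close> occurs \<open>3 - a\<close> times. Balance makes these two counts equal, so \<open>a = 1\<close>.\<close>

lemma nonzero_test_product:
  assumes l: "l \<in> labellings"
    and nz: "(\<Prod>i\<in>{1..2 * (3 * CARD('n) - 1)}. test_vector h i (l i)) \<noteq> (0 :: (nat, 'k::comm_ring_1) mpoly)"
  shows "l \<in> test_labelling h ` {2,3,4}"
proof -
  let ?I = "{1..2 * (3 * CARD('n) - 1)}"
  have "0 < CARD('n)" by simp
  have I: "1 \<in> ?I" "{2,3,4} \<subseteq> ?I"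
    using first_four[of 1] first_four by auto
  have nz': "test_vector h i (l i) \<noteq> (0 :: (nat, 'k) mpoly)" if "i \<in> ?I" for i
    using nz prod_zero[of ?I "\<lambda>i. test_vector h i (l i) :: (nat, 'k) mpoly"] that by blast
  have out: "l i = base_label h i" if "i \<in> ?I" "i \<notin> {2,3,4}" for i
  proof (rule ccontr)
    assume "l i \<noteq> base_label h i"
    then have "test_vector h i (l i) = (0 :: (nat, 'k) mpoly)"
      unfolding test_vector_def using that(2) by simp
    then show False using nz'[OF that(1)] by simp
  qed
  have inn: "l i = Inl (h 0) \<or> l i = Inr (h 0)" if "i \<in> {2,3,4}" for i
  proof (rule ccontr)
    assume "\<not> ?thesis"
    then have "test_vector h i (l i) = (0 :: (nat, 'k) mpoly)"
      unfolding test_vector_def using that by simp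
    then show False using nz'[OF subsetD[OF I(2) that]] by simp
  qed
  have not_in: "i \<notin> {2,3,4} \<Longrightarrow> i \<in> ?I \<Longrightarrow> (l i = Inl (h 0) \<longleftrightarrow> i = 1) \<and> l i \<noteq> Inr (h 0)" for i
  proof -
    assume i: "i \<notin> {2,3,4}" "i \<in> ?I"
    have ne: "i \<noteq> 2 \<and> i \<noteq> 3 \<and> i \<noteq> 4 \<and> 1 \<le> i" using i by simp
    show ?thesis
      unfolding out[OF i(2,1)] base_label_eq_iff[OF i(2) \<open>0 < CARD('n)\<close>]
      using ne by linarith
  qed
  define A where "A = {i \<in> {2,3,4}. l i = Inl (h 0)}"
  have A: "A \<subseteq> {2,3,4}" "finite A" unfolding A_def by auto
  have "{i \<in> ?I. l i = Inl (h 0)} = insert 1 A"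
  proof (rule set_eqI)
    fix i
    show "i \<in> {i \<in> ?I. l i = Inl (h 0)} \<longleftrightarrow> i \<in> insert 1 A"
    proof (cases "i \<in> {2,3,4}")
      case True
      then have "i \<in> ?I" "i \<noteq> 1" using I by auto
      then show ?thesis using True unfolding A_def by blast
    next
      case False
      then have "i \<notin> A" unfolding A_def by blast
      then show ?thesis using not_in[OF False] I(1) by blast
    qed
  qed
  moreover have "1 \<notin> A" using A by auto
  ultimately have cl: "card {i \<in> ?I. l i = Inl (h 0)} = Suc (card A)"
    using A by simp
  have "{i \<in> ?I. l i = Inr (h 0)} = {2,3,4} - A"
  proof (rule set_eqI)
    fix i
    show "i \<in> {i \<in> ?I. l i = Inr (h 0)} \<longleftrightarrow> i \<in> {2,3,4} - A"
    proof (cases "i \<in> {2,3,4}")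
      case True
      then have "i \<in> ?I" using I by blast
      then show ?thesis using True inn[OF True] unfolding A_def by (cases "l i") simp_all
    next
      case False
      then show ?thesis using not_in[OF False] by blast
    qed
  qed
  then have cr: "card {i \<in> ?I. l i = Inr (h 0)} = 3 - card A"
    using A by (simp add: card_Diff_subset)
  have "card A \<le> 3"
    using card_mono[OF _ A(1)] by simp
  obtain t where t: "balanced (\<lambda>c. card {i \<in> ?I. l i = c}) t"
    using l unfolding labellings_def by blast
  have "Suc (card A) + (if h 0 = t then 1 else 0) = 3"
    using t[unfolded balanced_def, rule_format, of "Inl (h 0)"] unfolding cl by simp
  moreover have "3 - card A + (if h 0 = t then 1 else 0) = 3"
    using t[unfolded balanced_def, rule_format, of "Inr (h 0)"] unfolding cr by simp
  ultimately have "card A = 1"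
    using \<open>card A \<le> 3\<close> by (simp split: if_splits)
  then obtain j where j: "A = {j}"
    by (rule card_1_singletonE)
  have "l = test_labelling h j"
  proof
    fix i
    consider "i \<notin> ?I" | "i \<in> ?I" "i \<notin> {2,3,4}" | "i \<in> {2,3,4}" "i = j" | "i \<in> {2,3,4}" "i \<noteq> j"
      by blast
    then show "l i = test_labelling h j i"
    proof cases
      case 1
      have "l \<in> ?I \<rightarrow>\<^sub>E UNIV" using l unfolding labellings_def by blast
      from PiE_arb[OF this 1] show ?thesis
        unfolding test_labelling_def restrict_def using 1 by (simp only: if_False)
    next
      case 2
      then have "i \<noteq> j" using j A by blast
      then show ?thesis
        using out[OF 2] 2 by (simp add: test_labelling_def)
    next
      case 3
      then have "l i = Inl (h 0)" "i \<in> ?I" using j I unfolding A_def by blast+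
      then show ?thesis using 3 by (simp add: test_labelling_def)
    next
      case 4
      then have "l i = Inr (h 0)" "i \<in> ?I" using j I inn[of i] unfolding A_def by blast+
      moreover have "base_label h i = Inr (h 0)"
        using 4(1) by (auto simp: base_label_def)
      ultimately show ?thesis using 4 by (simp add: test_labelling_def)
    qed
  qed
  moreover have "j \<in> {2,3,4}" using j A by blast
  ultimately show ?thesis by blast
qed

lemma test_product:
  assumes j: "j \<in> {2,3,4}"
  shows "(\<Prod>i\<in>{1..2 * (3 * CARD('n) - 1)}. test_vector h i (test_labelling h j i)) =
    (Var 0 * Var 2 * Var 3 * Var 4 :: (nat, 'k::comm_ring_1) mpoly)"
proof -
  let ?I = "{1..2 * (3 * CARD('n) - 1)}"
  let ?f = "\<lambda>i. test_vector h i (test_labelling h j i) :: (nat, 'k) mpoly"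
  have I: "{2,3,4} \<subseteq> ?I"
    using first_four by auto
  have "prod ?f ?I = prod ?f (?I - {2,3,4}) * prod ?f {2,3,4}"
    by (rule prod.subset_diff[OF I]) simp
  also have "prod ?f (?I - {2,3,4}) = 1"
  proof (rule prod.neutral, rule ballI)
    fix i assume i: "i \<in> ?I - {2,3,4}"
    then have "i \<noteq> j" using j by blast
    then have "test_labelling h j i = base_label h i"
      using i by (simp add: test_labelling_def)
    then show "?f i = 1"
      using i unfolding test_vector_def by simp
  qed
  also have "prod ?f {2,3,4} = Var 0 * Var 2 * Var 3 * Var 4"
  proof -
    have "?f i = (if i = j then Var 0 * Var i else Var i)" if "i \<in> {2,3,4}" for i
    proof -
      have "base_label h i = Inr (h 0)"
        using that by (auto simp: base_label_def)
      moreover have "i \<in> ?I" using I that by blast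
      ultimately have "test_labelling h j i = (if i = j then Inl (h 0) else Inr (h 0))"
        by (simp add: test_labelling_def)
      then show ?thesis
        using that unfolding test_vector_def by simp
    qed
    then have "prod ?f {2,3,4} = (\<Prod>i\<in>{2,3,4}. if i = j then Var 0 * Var i else Var i)"
      by (rule prod.cong[OF refl])
    then show ?thesis using j by (auto simp: mult_ac)
  qed
  finally show ?thesis by simp
qed

text \<open>Each of the three surviving labellings contributes the same monomial, and 3 is odd.\<close>

lemma multilinear_form_test_vector:
  assumes two: "(2::'k::comm_ring_1) = 0"
  shows "multilinear_form (test_vector h) = (Var 0 * Var 2 * Var 3 * Var 4 :: (nat, 'k) mpoly)"
proof -
  let ?I = "{1..2 * (3 * CARD('n) - 1)}"
  let ?g = "\<lambda>l. \<Prod>i\<in>?I. test_vector h i (l i) :: (nat, 'k) mpoly"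
  let ?X = "Var 0 * Var 2 * Var 3 * Var 4 :: (nat, 'k) mpoly"
  have fin: "finite (labellings :: (nat \<Rightarrow> 'n + 'n) set)"
    by (rule finite_subset[of _ "?I \<rightarrow>\<^sub>E UNIV"]) (auto simp: labellings_def intro!: finite_PiE)
  have inj: "inj_on (test_labelling h) {2,3,4}"
  proof (rule inj_onI)
    fix j j' assume j: "j \<in> {2,3,4}" "j' \<in> {2,3,4}" and eq: "test_labelling h j = test_labelling h j'"
    have "{1, j} = {1, j'}"
      using test_labelling_count_first(1)[OF j(1)] test_labelling_count_first(1)[OF j(2)]
      by (simp only: eq)
    then show "j = j'" using j by (auto simp: doubleton_eq_iff)
  qed
  have "multilinear_form (test_vector h) = sum ?g labellings"
    by (simp add: multilinear_form_def)
  also have "\<dots> = sum ?g (test_labelling h ` {2,3,4})"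
  proof (rule sum.mono_neutral_right[OF fin])
    show "test_labelling h ` {2,3,4} \<subseteq> labellings"
      using test_labelling_in_labellings by blast
    show "\<forall>l\<in>labellings - test_labelling h ` {2,3,4}. ?g l = 0"
      using nonzero_test_product[where 'k = 'k] by blast
  qed
  also have "\<dots> = (\<Sum>j\<in>{2,3,4}. ?g (test_labelling h j))"
    by (rule sum.reindex[OF inj, unfolded comp_def])
  also have "\<dots> = (\<Sum>j\<in>{2,3,4::nat}. ?X)"
    by (rule sum.cong[OF refl]) (rule test_product)
  also have "\<dots> = 2 * ?X + ?X"
    by simp
  finally show ?thesis
    by (simp only: mpoly_two_eq_0[OF two] mult_zero_left add_0_left)
qed

end

lemma separating_monomial_notin:
  "(Var 0 * Var 2 * Var 3 * Var 4 :: (nat, 'k::comm_ring_1) mpoly) \<notin> half_degree_subring"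
  by (simp add: half_degree_subring_def Var_def mult_single lookup_add lookup_single)

lemma f_poly_not_expressible:
  assumes two: "(2::'k::comm_ring_1) = 0"
  shows "\<not> expressible_in_QB m (f_poly :: ('n::finite coord, 'k) mpoly)"
proof
  assume ex: "expressible_in_QB m (f_poly :: ('n coord, 'k) mpoly)"
  obtain h :: "nat \<Rightarrow> 'n" where h: "bij_betw h {..<CARD('n)} UNIV"
    using ex_bij_betw_nat_finite[of "UNIV :: 'n set"] by (auto simp: atLeast0LessThan)
  have "mpoly_subst (\<lambda>(c, i). test_vector h i c) (f_poly :: ('n coord, 'k) mpoly) = multilinear_form (test_vector h)"
    by (simp add: f_poly_eq_multilinear_form mpoly_subst_multilinear_form ivec_def)
  then have "multilinear_form (test_vector h) \<in> (half_degree_subring :: (nat, 'k) mpoly set)"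
    using expressible_test_value[OF h two ex] by simp
  then show False
    unfolding multilinear_form_test_vector[OF h two] using separating_monomial_notin by blast
qed

theorem theorem2p9:
  fixes f :: "('n::finite coord, 'k::alg_closed_field) mpoly" and m :: nat
  assumes "CHAR('k) = 2"
    and "m \<ge> 2 * (3 * CARD('n) - 1)"
    and "f = f_poly"
  shows "f \<in> orth_invariants m \<and> \<not> expressible_in_QB m f"
proof -
  have two: "(2::'k) = 0"
    using of_nat_CHAR[where 'a = 'k] assms(1) by simp
  show ?thesis
    unfolding orth_invariants_def assms(3)
    using f_poly_in_R_alg[OF assms(2)] orth_act_f_poly[OF _ two] f_poly_not_expressible[OF two] by blast
qed

end
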